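(* Let $\mathcal{B}$ consist of all subsets $B\subset \{1,\dots,10\}$ with $|B|=4$ except for \[\{1,2,3,4\},\ \{1,2,5,6\},\ \{1,2,7,8\},\ \{1,2,9,10\},\ \{3,4,5,6\},\ \{5,6,7,8\},\ \{7,8,9,10\}.\] Then $\mathcal{B}$ is the collection of bases of a matroid on $\{1,\dots,10\}$, and its basis generating polynomial \[f_{10}(x)=\sum_{B\in\mathcal{B}}\prod_{i\in B}x_i\in\mathbb{R}[x_1,\dots,x_{10}]\] is stable; that is, the rank-four matroid $V_{10}$ with bases $\mathcal{B}$ has the half-plane property. Furthermore, no power of $f_{10}$ has a definite determinantal representation.
   Context: A homogeneous polynomial $f\in\mathbb{R}[x_1,\dots,x_n]$ is called stable if for every $v\in(\mathbb{R}_{>0})^n$ and every $w\in\mathbb{R}^n$, the univariate polynomial $f(tv+w)\in\mathbb{R}[t]$ has only real roots. A matroid on $\{1,\dots,n\}$ has the half-plane property if its basis generating polynomial $\sum_{B\text{ basis}}\prod_{i\in B}x_i$ is stable. A power $f^k$ ($k$ a positive integer) of a polynomial $f\in\mathbb{R}[x_1,\dots,x_n]$ has a definite determinantal representation if $f^k=\det(x_1A_1+\cdots+x_nA_n)$ for some positive semidefinite Hermitian matrices $A_1,\dots,A_n$ of a common size. *)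

theory Defs
  imports "HOL-Computational_Algebra.Polynomial" "Jordan_Normal_Form.Determinant"
begin

text \<open>Multivariate polynomials in variables x_i, i in a finite ground set E, are rendered
  as explicit sums of products evaluated at points x :: nat => 'a.\<close>

definition matroid_bases :: "nat set \<Rightarrow> nat set set \<Rightarrow> bool" where
  "matroid_bases E \<B> \<longleftrightarrow> finite E \<and> \<B> \<noteq> {} \<and> (\<forall>B\<in>\<B>. B \<subseteq> E) \<and>
     (\<forall>B1\<in>\<B>. \<forall>B2\<in>\<B>. \<forall>x\<in>B1 - B2. \<exists>y\<in>B2 - B1. insert y (B1 - {x}) \<in> \<B>)"

definition basis_gen_poly :: "nat set set \<Rightarrow> (nat \<Rightarrow> 'a::comm_ring_1) \<Rightarrow> 'a" where
  "basis_gen_poly \<B> x = (\<Sum>B\<in>\<B>. \<Prod>i\<in>B. x i)"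

definition half_plane_property :: "nat set \<Rightarrow> nat set set \<Rightarrow> bool" where
  "half_plane_property E \<B> \<longleftrightarrow>
     (\<forall>v w :: nat \<Rightarrow> real. (\<forall>i\<in>E. v i > 0) \<longrightarrow>
        (\<forall>z::complex. poly (map_poly complex_of_real
            (basis_gen_poly \<B> (\<lambda>i. [:w i, v i:]))) z = 0 \<longrightarrow> z \<in> \<real>))"

definition hermitian_mat :: "nat \<Rightarrow> complex mat \<Rightarrow> bool" where
  "hermitian_mat d A \<longleftrightarrow> A \<in> carrier_mat d d \<and>
     (\<forall>r<d. \<forall>c<d. A $$ (c, r) = cnj (A $$ (r, c)))"

definition psd_hermitian_mat :: "nat \<Rightarrow> complex mat \<Rightarrow> bool" where
  "psd_hermitian_mat d A \<longleftrightarrow> hermitian_mat d A \<and>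
     (\<forall>u :: nat \<Rightarrow> complex. Re (\<Sum>r<d. \<Sum>c<d. cnj (u r) * A $$ (r, c) * u c) \<ge> 0)"

text \<open>F^k = det(sum_i x_i A_i) with A_i PSD Hermitian of a common size d
  (identity of polynomial functions on R^E, equivalent to polynomial identity).\<close>
definition has_definite_det_rep :: "nat set \<Rightarrow> ((nat \<Rightarrow> real) \<Rightarrow> real) \<Rightarrow> nat \<Rightarrow> bool" where
  "has_definite_det_rep E F k \<longleftrightarrow>
     (\<exists>(d::nat) (A :: nat \<Rightarrow> complex mat). (\<forall>i\<in>E. psd_hermitian_mat d (A i)) \<and>
        (\<forall>x :: nat \<Rightarrow> real. complex_of_real (F x ^ k) =
            det (mat d d (\<lambda>(r, c). \<Sum>i\<in>E. complex_of_real (x i) * A i $$ (r, c)))))"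

definition V10_bases :: "nat set set" where
  "V10_bases = {B. B \<subseteq> {1..10} \<and> card B = 4} -
     {{1,2,3,4}, {1,2,5,6}, {1,2,7,8}, {1,2,9,10}, {3,4,5,6}, {5,6,7,8}, {7,8,9,10}}"

end

(* Writing s_j and p_j for the sum and the product of the variables in the j-th pair {2j-1, 2j},
   f_10 is affine in every (s_j, p_j), so by the Grace-Walsh-Szego theorem in degree two a zero of
   f_10 in the product of upper half planes yields such a zero y of the form obtained by setting
   both variables of each pair equal, which is
     g = 4 (y + e_1) (e_2 y + e_3) + a^2 c^2 + a^2 d^2 + b^2 d^2,
   the e_i being the elementary symmetric polynomials in a, b, c, d.  With q = e_2 (2 y + e_1) + e_3
   one has e_2 g <= q^2 on real points.  Along a generic real line of positive direction, q has three
   roots separating the two roots of e_2, so g has signs <= 0, >= 0, <= 0 there; a real quartic with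
   positive leading coefficient and a non-real root is a positive quadratic times a strictly convex
   one, which excludes these signs.  Non-generic lines follow by a limit.

   If f_10^k = det (sum_i x_i A_i), let K_S be the common kernel of the A_i with i in S, inside C^d
   with d = 4k.  The order of vanishing at t = 0 of det (sum_{i in S} A_i + t sum_i A_i) is at most
   dim K_S, so k (4 - r) <= dim K_S when S meets every basis in at most r elements, whereas
   K_B = 0 for a basis B.  The pairs {1,2}, {5,6}, {3,4}, {7,8} form a Vamos configuration, and the
   kernels would violate the dual Ingleton inequality. *)

theory Submission
  imports Defs "Jordan_Normal_Form.Char_Poly" "HOL-Library.Function_Algebras"
begin

section \<open>The half-plane property\<close>

definition es1 :: "'a::comm_ring_1 \<Rightarrow> 'a \<Rightarrow> 'a \<Rightarrow> 'a \<Rightarrow> 'a" where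
  "es1 a b c d = a + b + c + d"

definition es2 :: "'a::comm_ring_1 \<Rightarrow> 'a \<Rightarrow> 'a \<Rightarrow> 'a \<Rightarrow> 'a" where
  "es2 a b c d = a*b + a*c + a*d + b*c + b*d + c*d"

definition es3 :: "'a::comm_ring_1 \<Rightarrow> 'a \<Rightarrow> 'a \<Rightarrow> 'a \<Rightarrow> 'a" where
  "es3 a b c d = a*b*c + a*b*d + a*c*d + b*c*d"

text \<open>This is f_10 with the two variables of each pair set equal: \<open>y\<close> for {1,2},
  and \<open>a\<close>, \<open>b\<close>, \<open>c\<close>, \<open>d\<close> for {3,4}, {5,6},
  {7,8}, {9,10}. The three squares come from the unions of two pairs that are bases.\<close>

definition diag_form :: "'a::comm_ring_1 \<Rightarrow> 'a \<Rightarrow> 'a \<Rightarrow> 'a \<Rightarrow> 'a \<Rightarrow> 'a" where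
  "diag_form y a b c d = 4 * (y + es1 a b c d) * (es2 a b c d * y + es3 a b c d)
     + (a^2*c^2 + a^2*d^2 + b^2*d^2)"

text \<open>A quarter of the derivative of \<open>diag_form\<close> in \<open>y\<close>. Its zeros
  along a line serve as test points for the sign of \<open>diag_form\<close>.\<close>

definition interlacer :: "'a::comm_ring_1 \<Rightarrow> 'a \<Rightarrow> 'a \<Rightarrow> 'a \<Rightarrow> 'a \<Rightarrow> 'a" where
  "interlacer y a b c d = es2 a b c d * (2*y + es1 a b c d) + es3 a b c d"

lemmas form_defs = es1_def es2_def es3_def diag_form_def interlacer_def

text \<open>As a quadratic in \<open>y\<close>, \<open>diag_form\<close> has leading coefficient 4
  e_2 and derivative 4 \<open>interlacer\<close>. Completing the square turns the difference of the
  two sides into a sixteenth of the discriminant, which is free of \<open>y\<close>.\<close>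

lemma es2_mult_diag_form_le:
  fixes y a b c d :: real
  shows "es2 a b c d * diag_form y a b c d \<le> (interlacer y a b c d)^2"
proof -
  define R where "R = a^2*c^2 + a^2*d^2 + b^2*d^2"
  let ?e1 = "es1 a b c d" and ?e2 = "es2 a b c d" and ?e3 = "es3 a b c d"
  have R0: "R \<ge> 0" unfolding R_def by simp
  have *: "(interlacer y a b c d)^2 - ?e2 * diag_form y a b c d = (?e1 * ?e2 - ?e3)^2 - ?e2 * R"
    unfolding interlacer_def diag_form_def R_def[symmetric]
    by (simp add: power2_eq_square algebra_simps)
  have "(?e1 * ?e2 - ?e3)^2 - ?e2 * R \<ge> 0"
  proof (cases "?e2 \<ge> 0")
    case True
    \<comment> \<open>Replacing R by the sum of all six products of squares makes the difference manifestly nonnegative.\<close>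
    have "R \<le> R + (a^2*b^2 + b^2*c^2 + c^2*d^2)" by simp
    then have "?e2 * R \<le> ?e2 * (R + (a^2*b^2 + b^2*c^2 + c^2*d^2))"
      by (rule mult_left_mono[OF _ True])
    moreover have "(?e1 * ?e2 - ?e3)^2 - ?e2 * (R + (a^2*b^2 + b^2*c^2 + c^2*d^2)) =
       ?e2^2 * (a^2 + b^2 + c^2 + d^2 + ?e2)
       + ((a*b*c)^2 + (a*b*d)^2 + (a*c*d)^2 + (b*c*d)^2)"
      unfolding form_defs R_def by Groebner_Basis.algebra
    moreover have "?e2^2 * (a^2 + b^2 + c^2 + d^2 + ?e2) \<ge> 0" using True by simp
    ultimately show ?thesis
      by (smt (verit) zero_le_power2)
  next
    case False
    then have "?e2 * R \<le> 0" using R0 by (simp add: mult_nonpos_nonneg)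
    then show ?thesis by (smt (verit) zero_le_power2)
  qed
  with * show ?thesis by simp
qed

text \<open>Newton's inequality with constant 1 in place of 3, made strict: twice the difference is
  a sum of three squares, which vanish together only if all pairwise products do.\<close>

lemma newton_three_strict:
  fixes x y z :: real
  assumes "\<not> (x = 0 \<and> y = 0)" "\<not> (x = 0 \<and> z = 0)" "\<not> (y = 0 \<and> z = 0)"
  shows "(x + y + z) * (x*y*z) < (x*y + y*z + z*x)^2"
proof -
  define A B where "A = (x*y + y*z + z*x)^2" and "B = (x + y + z) * (x*y*z)"
  have "2 * (A - B) =
      (x*y + y*z)^2 + (y*z + z*x)^2 + (z*x + x*y)^2"
    unfolding A_def B_def by Groebner_Basis.algebra
  moreover have "(x*y + y*z)^2 + (y*z + z*x)^2 + (z*x + x*y)^2 > 0"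
  proof (rule ccontr)
    assume "\<not> ?thesis"
    then have "(x*y + y*z)^2 = 0" "(y*z + z*x)^2 = 0" "(z*x + x*y)^2 = 0"
      by (smt (verit) zero_le_power2)+
    then have "x*y + y*z = 0" "y*z + z*x = 0" "z*x + x*y = 0" by simp_all
    then have "x*y = 0" "y*z = 0" "z*x = 0" by linarith+
    with assms show False by auto
  qed
  ultimately have "B < A" by argo
  then show ?thesis unfolding A_def B_def .
qed

text \<open>The factor b + c + d is the partial derivative of e_2 in \<open>a\<close>. On e_2 = 0
  the product a (b + c + d) equals minus the second symmetric function of b, c, d, which reduces the
  claim to Newton's inequality in these three variables.\<close>

lemma es3_mult_partial_es2_neg:
  fixes a b c d :: real
  assumes "es2 a b c d = 0"
    and "\<not> (b = 0 \<and> c = 0)" "\<not> (b = 0 \<and> d = 0)" "\<not> (c = 0 \<and> d = 0)"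
  shows "es3 a b c d * (b + c + d) < 0"
proof -
  have "a * (b + c + d) = - (b*c + c*d + d*b)"
    using assms(1) by (simp add: es2_def algebra_simps)
  then have "es3 a b c d * (b + c + d) = (b + c + d) * (b*c*d) - (b*c + c*d + d*b)^2"
    unfolding es3_def by Groebner_Basis.algebra
  then show ?thesis using newton_three_strict[of b c d] assms(2-) by simp
qed

text \<open>The second factor is the derivative of e_2 in the direction (a', b', c', d'), a positive
  combination of its partial derivatives. It ties the sign of e_3 to the slope of e_2 at a
  root.\<close>

lemma es3_mult_derivative_es2_neg:
  fixes a b c d a' b' c' d' :: real
  assumes e2: "es2 a b c d = 0"
    and nz: "\<not> (a = 0 \<and> b = 0)" "\<not> (a = 0 \<and> c = 0)" "\<not> (a = 0 \<and> d = 0)"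
      "\<not> (b = 0 \<and> c = 0)" "\<not> (b = 0 \<and> d = 0)" "\<not> (c = 0 \<and> d = 0)"
    and pos: "a' > 0" "b' > 0" "c' > 0" "d' > 0"
  shows "es3 a b c d * (a'*(b+c+d) + b'*(a+c+d) + c'*(a+b+d) + d'*(a+b+c)) < 0"
proof -
  let ?E = "es3 a b c d"
  have "?E * (b+c+d) < 0" using es3_mult_partial_es2_neg[of a b c d] e2 nz by blast
  moreover have "?E * (a+c+d) < 0"
    using es3_mult_partial_es2_neg[of b a c d] e2 nz by (simp add: es2_def es3_def algebra_simps)
  moreover have "?E * (a+b+d) < 0"
    using es3_mult_partial_es2_neg[of c a b d] e2 nz by (simp add: es2_def es3_def algebra_simps)
  moreover have "?E * (a+b+c) < 0"
    using es3_mult_partial_es2_neg[of d a b c] e2 nz by (simp add: es2_def es3_def algebra_simps)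
  ultimately have "a' * (?E * (b+c+d)) < 0" "b' * (?E * (a+c+d)) < 0"
    "c' * (?E * (a+b+d)) < 0" "d' * (?E * (a+b+c)) < 0"
    using pos by (auto simp: mult_pos_neg)
  then show ?thesis by (simp add: algebra_simps)
qed

lemma affine_pos_eventually:
  fixes u v :: real
  assumes "v > 0"
  shows "\<exists>T. \<forall>t>T. u + t * v > 0"
  using assms by (intro exI[of _ "- u / v"]) (auto simp: field_simps)

lemma affine_neg_eventually:
  fixes u v :: real
  assumes "v > 0"
  shows "\<exists>T. \<forall>t<T. u + t * v < 0"
  using assms by (intro exI[of _ "- u / v"]) (auto simp: field_simps)

lemma es2_neg_of_es1_zero:
  fixes a b c d :: real
  assumes "es1 a b c d = 0" "a \<noteq> 0 \<or> b \<noteq> 0"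
  shows "es2 a b c d < 0"
proof -
  have "2 * es2 a b c d = (es1 a b c d)^2 - (a^2 + b^2 + c^2 + d^2)"
    unfolding es1_def es2_def by Groebner_Basis.algebra
  moreover have "a^2 + b^2 > 0" using assms(2) by (simp add: sum_power2_gt_zero_iff)
  moreover have "c^2 + d^2 \<ge> 0" by simp
  ultimately have "2 * es2 a b c d < (es1 a b c d)^2" by linarith
  then show ?thesis using assms(1) by simp
qed

text \<open>The roots of \<open>interlacer\<close> and \<open>es2\<close> alternate along the line,
  and the former are the test points. The inequalities \<open>gen\<close> say that no two of the
  last four coordinates vanish at the same parameter, as \<open>es3_mult_derivative_es2_neg\<close>
  demands.\<close>

lemma diag_form_line_signs:
  fixes y a b c d y' a' b' c' d' :: real
  assumes pos: "y' > 0" "a' > 0" "b' > 0" "c' > 0" "d' > 0"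
    and gen: "a*b' \<noteq> b*a'" "a*c' \<noteq> c*a'" "a*d' \<noteq> d*a'" "b*c' \<noteq> c*b'" "b*d' \<noteq> d*b'" "c*d' \<noteq> d*c'"
  defines "G \<equiv> \<lambda>t. diag_form (y + t*y') (a + t*a') (b + t*b') (c + t*c') (d + t*d')"
  shows "\<exists>t1 t2 t3. t1 < t2 \<and> t2 < t3 \<and> G t1 \<le> 0 \<and> G t2 \<ge> 0 \<and> G t3 \<le> 0"
proof -
  define e2 where "e2 = (\<lambda>t. es2 (a + t*a') (b + t*b') (c + t*c') (d + t*d'))"
  define e3 where "e3 = (\<lambda>t. es3 (a + t*a') (b + t*b') (c + t*c') (d + t*d'))"
  define q where "q = (\<lambda>t. interlacer (y + t*y') (a + t*a') (b + t*b') (c + t*c') (d + t*d'))"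
  have conte2: "continuous_on A e2" and contq: "continuous_on A q" for A
    unfolding e2_def q_def form_defs by (intro continuous_intros)+
  obtain P where P: "\<And>t. t > P \<Longrightarrow> y + t*y' > 0 \<and> a + t*a' > 0 \<and> b + t*b' > 0 \<and> c + t*c' > 0 \<and> d + t*d' > 0"
  proof -
    obtain T1 T2 T3 T4 T5 where "\<forall>t>T1. y + t*y' > 0" "\<forall>t>T2. a + t*a' > 0"
      "\<forall>t>T3. b + t*b' > 0" "\<forall>t>T4. c + t*c' > 0" "\<forall>t>T5. d + t*d' > 0"
      using affine_pos_eventually pos by metis
    then show thesis by (intro that[of "Max {T1,T2,T3,T4,T5}"]) auto
  qed
  obtain N where N: "\<And>t. t < N \<Longrightarrow> y + t*y' < 0 \<and> a + t*a' < 0 \<and> b + t*b' < 0 \<and> c + t*c' < 0 \<and> d + t*d' < 0"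
  proof -
    obtain T1 T2 T3 T4 T5 where "\<forall>t<T1. y + t*y' < 0" "\<forall>t<T2. a + t*a' < 0"
      "\<forall>t<T3. b + t*b' < 0" "\<forall>t<T4. c + t*c' < 0" "\<forall>t<T5. d + t*d' < 0"
      using affine_neg_eventually pos by metis
    then show thesis by (intro that[of "Min {T1,T2,T3,T4,T5}"]) auto
  qed
  have e2P: "e2 t > 0" and qP: "q t > 0" if "t > P" for t
    using P[OF that] unfolding e2_def q_def form_defs by (simp_all add: add_pos_pos)
  have e2N: "e2 t > 0" and qN: "q t < 0" if "t < N" for t
  proof -
    note n = N[OF that]
    show e: "e2 t > 0" using n unfolding e2_def es2_def by (simp add: add_pos_pos mult_neg_neg)
    have "e3 t < 0" using n unfolding e3_def es3_def by (intro add_neg_neg) (auto simp: mult_neg_neg mult_pos_neg)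
    moreover have "2 * (y + t*y') + es1 (a + t*a') (b + t*b') (c + t*c') (d + t*d') < 0"
      using n unfolding es1_def by argo
    ultimately show "q t < 0" using e unfolding q_def interlacer_def e2_def e3_def
      by (smt (verit) mult_pos_neg)
  qed
  \<comment> \<open>The zero of e_1 on the line. There e_2 is negative, while it is positive far out
    in both directions, so it has a root on either side of \<open>s\<close>.\<close>
  define s where "s = - (a + b + c + d) / (a' + b' + c' + d')"
  have "es1 (a + s*a') (b + s*b') (c + s*c') (d + s*d') = (a+b+c+d) + s * (a'+b'+c'+d')"
    by (simp add: es1_def algebra_simps)
  also have "\<dots> = 0" using pos unfolding s_def by (simp add: field_simps)
  finally have "es1 (a + s*a') (b + s*b') (c + s*c') (d + s*d') = 0" .
  moreover have indep: "\<not> (x1 + t*x2 = 0 \<and> z1 + t*z2 = 0)" if "x1 * z2 \<noteq> z1 * x2" for t x1 x2 z1 z2 :: real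
    using that by Groebner_Basis.algebra
  ultimately have e2s: "e2 s < 0" unfolding e2_def using indep[OF gen(1), of s] by (intro es2_neg_of_es1_zero) auto
  obtain r1 where r1: "r1 < s" "e2 r1 = 0"
  proof -
    define n where "n = min N s - 1"
    have "e2 n > 0" by (rule e2N) (simp add: n_def)
    moreover have "n \<le> s" by (simp add: n_def)
    ultimately obtain x where "n \<le> x" "x \<le> s" "e2 x = 0"
      using IVT2'[of e2 s 0 n] e2s conte2 by force
    then show thesis using e2s by (intro that[of x]) (auto simp: order_less_le)
  qed
  obtain r2 where r2: "s < r2" "e2 r2 = 0"
  proof -
    define n where "n = max P s + 1"
    have "e2 n > 0" by (rule e2P) (simp add: n_def)
    moreover have "s \<le> n" by (simp add: n_def)
    ultimately obtain x where "s \<le> x" "x \<le> n" "e2 x = 0"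
      using IVT'[of e2 s 0 n] e2s conte2 by force
    then show thesis using e2s by (intro that[of x]) (auto simp: order_less_le)
  qed
  \<comment> \<open>\<open>L\<close> and \<open>D\<close> are the leading coefficient and the
    derivative of the quadratic \<open>e2\<close>. Expanding it about one root and evaluating at the
    other gives the slopes at both roots.\<close>
  define L where "L = es2 a' b' c' d'"
  have L: "L > 0" unfolding L_def es2_def using pos by (simp add: add_pos_pos)
  define D where "D = (\<lambda>t. a'*((b+t*b')+(c+t*c')+(d+t*d')) + b'*((a+t*a')+(c+t*c')+(d+t*d'))
      + c'*((a+t*a')+(b+t*b')+(d+t*d')) + d'*((a+t*a')+(b+t*b')+(c+t*c')))"
  have e2_expand: "e2 t = e2 x + (t - x) * D x + (t - x)^2 * L" for t x
    unfolding e2_def D_def L_def es2_def by Groebner_Basis.algebra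
  have "(r2 - r1) * (D r1 + (r2 - r1) * L) = 0"
    using e2_expand[of r2 r1] r1(2) r2(2) by (simp add: algebra_simps power2_eq_square)
  then have "D r1 + (r2 - r1) * L = 0" using r1 r2 by auto
  then have D1: "D r1 = - (r2 - r1) * L" by argo
  have "(r1 - r2) * (D r2 + (r1 - r2) * L) = 0"
    using e2_expand[of r1 r2] r1(2) r2(2) by (simp add: algebra_simps power2_eq_square)
  then have "D r2 + (r1 - r2) * L = 0" using r1 r2 by auto
  then have D2: "D r2 = (r2 - r1) * L" by argo
  have e2_factor: "e2 t = L * ((t - r1) * (t - r2))" for t
    using e2_expand[of t r1] D1 r1(2) by (simp add: algebra_simps power2_eq_square)
  \<comment> \<open>The slope of \<open>e2\<close> is negative at \<open>r1\<close> and positive at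
    \<open>r2\<close>, so \<open>e3\<close> is positive at \<open>r1\<close> and negative at
    \<open>r2\<close>. There \<open>q\<close> agrees with \<open>e3\<close>, which yields a root of
    \<open>q\<close> between the two and one on each outer side.\<close>
  have wr: "e3 r * D r < 0" if "e2 r = 0" for r
    unfolding e3_def D_def using that pos gen
    by (intro es3_mult_derivative_es2_neg indep) (simp_all add: e2_def)
  have "D r1 < 0" "D r2 > 0" using D1 D2 r1(1) r2(1) L by (auto simp: mult_neg_pos)
  then have "e3 r1 > 0" "e3 r2 < 0" using wr[OF r1(2)] wr[OF r2(2)]
    by (auto simp: mult_less_0_iff)
  moreover have "q t = e3 t" if "e2 t = 0" for t
    using that unfolding q_def e3_def e2_def interlacer_def by simp
  ultimately have q1: "q r1 > 0" and q2: "q r2 < 0" using r1(2) r2(2) by auto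
  obtain t1 where t1: "t1 < r1" "q t1 = 0"
  proof -
    define n where "n = min N r1 - 1"
    have "q n < 0" by (rule qN) (simp add: n_def)
    moreover have "n \<le> r1" by (simp add: n_def)
    ultimately obtain x where "n \<le> x" "x \<le> r1" "q x = 0"
      using IVT'[of q n 0 r1] q1 contq by force
    then show thesis using q1 by (intro that[of x]) (auto simp: order_less_le)
  qed
  obtain t2 where t2: "r1 < t2" "t2 < r2" "q t2 = 0"
  proof -
    obtain x where "r1 \<le> x" "x \<le> r2" "q x = 0"
      using IVT2'[of q r2 0 r1] q1 q2 contq r1 r2 by force
    then show thesis using q1 q2 by (intro that[of x]) (auto simp: order_less_le)
  qed
  obtain t3 where t3: "r2 < t3" "q t3 = 0"
  proof -
    define n where "n = max P r2 + 1"
    have "q n > 0" by (rule qP) (simp add: n_def)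
    moreover have "r2 \<le> n" by (simp add: n_def)
    ultimately obtain x where "r2 \<le> x" "x \<le> n" "q x = 0"
      using IVT'[of q r2 0 n] q2 contq by force
    then show thesis using q2 by (intro that[of x]) (auto simp: order_less_le)
  qed
  \<comment> \<open>Where \<open>q\<close> vanishes, the inequality between e_2 g and q^2 forces the
    sign of \<open>G\<close> to be weakly opposite to that of \<open>e2\<close>.\<close>
  have le: "e2 t * G t \<le> 0" if "q t = 0" for t
    using es2_mult_diag_form_le[of "a + t*a'" "b + t*b'" "c + t*c'" "d + t*d'" "y + t*y'"] that
    unfolding e2_def G_def q_def by simp
  have "e2 t1 > 0" "e2 t2 < 0" "e2 t3 > 0" unfolding e2_factor using L t1 t2 t3 r1 r2
    by (auto simp: mult_pos_neg mult_neg_pos mult_neg_neg)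
  then have "G t1 \<le> 0" "G t2 \<ge> 0" "G t3 \<le> 0"
    using le[OF t1(2)] le[OF t2(3)] le[OF t3(2)] by (auto simp: mult_le_0_iff)
  moreover have "t1 < t2" "t2 < t3" using t1 t2 t3 by auto
  ultimately show ?thesis by blast
qed

section \<open>Real quartics with a prescribed sign pattern\<close>

text \<open>The second divided difference of the three values is A > 0, whereas the assumed signs
  make it nonpositive.\<close>

lemma no_convex_quadratic_sign_pattern:
  fixes A B C t1 t2 t3 :: real
  assumes "A > 0" "t1 < t2" "t2 < t3"
    and "A*t1^2 + B*t1 + C \<le> 0" "A*t2^2 + B*t2 + C \<ge> 0" "A*t3^2 + B*t3 + C \<le> 0"
  shows False
proof -
  have "(t3 - t2) * (A*t1^2 + B*t1 + C) + (t2 - t1) * (A*t3^2 + B*t3 + C)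
      - (t3 - t1) * (A*t2^2 + B*t2 + C) = A * ((t2 - t1) * (t3 - t2) * (t3 - t1))"
    by Groebner_Basis.algebra
  moreover have "A * ((t2 - t1) * (t3 - t2) * (t3 - t1)) > 0" using assms by simp
  moreover have "(t3 - t2) * (A*t1^2 + B*t1 + C) \<le> 0" "(t2 - t1) * (A*t3^2 + B*t3 + C) \<le> 0"
    "(t3 - t1) * (A*t2^2 + B*t2 + C) \<ge> 0"
    using assms by (auto simp: mult_nonneg_nonpos)
  ultimately show False by linarith
qed

definition quartic :: "real \<Rightarrow> real \<Rightarrow> real \<Rightarrow> real \<Rightarrow> real \<Rightarrow> complex \<Rightarrow> complex" where
  "quartic c0 c1 c2 c3 c4 z = of_real c0 + of_real c1 * z + of_real c2 * z^2
     + of_real c3 * z^3 + of_real c4 * z^4"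

text \<open>A root at \<open>\<i>\<close> gives c1 = c3 and c2 = c0 + c4, so the quartic is t^2 + 1
  times the convex quadratic with coefficients c4, c3, c0, which inherits the sign pattern.\<close>

lemma quartic_sign_pattern_imp_no_root_ii:
  fixes t1 t2 t3 :: real
  assumes "c4 > 0" "t1 < t2" "t2 < t3"
    and "Re (quartic c0 c1 c2 c3 c4 t1) \<le> 0" "Re (quartic c0 c1 c2 c3 c4 t2) \<ge> 0"
      "Re (quartic c0 c1 c2 c3 c4 t3) \<le> 0"
  shows "quartic c0 c1 c2 c3 c4 \<i> \<noteq> 0"
proof
  assume "quartic c0 c1 c2 c3 c4 \<i> = 0"
  then have "c1 = c3" "c2 = c0 + c4"
    by (simp_all add: quartic_def complex_eq_iff power2_eq_square power3_eq_cube power4_eq_xxxx)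
  then have *: "Re (quartic c0 c1 c2 c3 c4 t) = (t^2 + 1) * (c4*t^2 + c3*t + c0)" for t :: real
    unfolding quartic_def
    by (simp add: power2_eq_square power3_eq_cube power4_eq_xxxx algebra_simps)
  have pos: "t^2 + 1 > (0::real)" for t by (smt (verit) zero_le_power2)
  show False
    using assms(4-6) pos unfolding *
    by (intro no_convex_quadratic_sign_pattern[OF assms(1-3), of c3 c0])
       (auto simp: mult_le_0_iff zero_le_mult_iff not_le[symmetric])
qed

lemma quartic_add:
  "quartic c0 c1 c2 c3 c4 z + quartic d0 d1 d2 d3 d4 z =
     quartic (c0 + d0) (c1 + d1) (c2 + d2) (c3 + d3) (c4 + d4) z"
  by (simp add: quartic_def algebra_simps)

lemma square_mult_square_line_quartic:
  fixes a c a' c' :: real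
  shows "(of_real a + z * of_real a')^2 * (of_real c + z * of_real c')^2 =
    quartic (a^2*c^2) (2*a*a'*c^2 + 2*a^2*c*c') (a'^2*c^2 + 4*a*a'*c*c' + a^2*c'^2)
      (2*a'^2*c*c' + 2*a*a'*c'^2) (a'^2*c'^2) z"
  unfolding quartic_def
  by (simp only: of_real_mult of_real_add of_real_power of_real_numeral) Groebner_Basis.algebra

text \<open>By homogeneity the leading coefficient along a line is the value of
  \<open>diag_form\<close> at the direction, which is positive for a positive direction. The other
  coefficients only have to be real.\<close>

lemma diag_form_line_quartic:
  fixes y a b c d y' a' b' c' d' :: real
  shows "\<exists>c0 c1 c2 c3. \<forall>z::complex. diag_form (y + z*y') (a + z*a') (b + z*b') (c + z*c') (d + z*d')
     = quartic c0 c1 c2 c3 (diag_form y' a' b' c' d') z"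
proof -
  define C0 C1 A0 A1 A2 B0 B1 B2 B3 where coeffs:
    "C0 = y + es1 a b c d" "C1 = y' + es1 a' b' c' d'"
    "A0 = es2 a b c d"
    "A1 = a*b' + a'*b + a*c' + a'*c + a*d' + a'*d + b*c' + b'*c + b*d' + b'*d + c*d' + c'*d"
    "A2 = es2 a' b' c' d'" "B0 = es3 a b c d"
    "B1 = a'*b*c + a*b'*c + a*b*c' + a'*b*d + a*b'*d + a*b*d' + a'*c*d + a*c'*d + a*c*d' + b'*c*d + b*c'*d + b*c*d'"
    "B2 = a*b'*c' + a'*b*c' + a'*b'*c + a*b'*d' + a'*b*d' + a'*b'*d + a*c'*d' + a'*c*d' + a'*c'*d + b*c'*d' + b'*c*d' + b'*c'*d"
    "B3 = es3 a' b' c' d'"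
  have C: "(y + z*y') + es1 (a + z*a') (b + z*b') (c + z*c') (d + z*d') = C0 + z * C1" for z :: complex
    unfolding coeffs es1_def by (simp add: algebra_simps)
  have A: "es2 (a + z*a') (b + z*b') (c + z*c') (d + z*d') = A0 + z * A1 + z^2 * A2" for z :: complex
    unfolding coeffs es2_def by (simp only: of_real_mult of_real_add) Groebner_Basis.algebra
  have B: "es3 (a + z*a') (b + z*b') (c + z*c') (d + z*d') = B0 + z * B1 + z^2 * B2 + z^3 * B3" for z :: complex
    unfolding coeffs es3_def by (simp only: of_real_mult of_real_add) Groebner_Basis.algebra
  have main: "4 * ((y + z*y') + es1 (a + z*a') (b + z*b') (c + z*c') (d + z*d'))
      * (es2 (a + z*a') (b + z*b') (c + z*c') (d + z*d') * (y + z*y') + es3 (a + z*a') (b + z*b') (c + z*c') (d + z*d'))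
    = quartic (4*C0*(A0*y + B0)) (4*(C0*(A0*y' + A1*y + B1) + C1*(A0*y + B0)))
        (4*(C0*(A1*y' + A2*y + B2) + C1*(A0*y' + A1*y + B1)))
        (4*(C0*(A2*y' + B3) + C1*(A1*y' + A2*y + B2))) (4*C1*(A2*y' + B3)) z" for z :: complex
    unfolding C A B quartic_def
    by (simp only: of_real_mult of_real_add of_real_numeral) Groebner_Basis.algebra
  have lead: "diag_form y' a' b' c' d' = 4*C1*(A2*y' + B3) + (a'^2*c'^2 + a'^2*d'^2 + b'^2*d'^2)"
    unfolding diag_form_def coeffs ..
  show ?thesis
    unfolding diag_form_def[of "_ + _"] main square_mult_square_line_quartic quartic_add lead
    by (intro exI allI) (rule refl)
qed

lemma diag_form_of_real: "diag_form (of_real y) (of_real a) (of_real b) (of_real c) (of_real d)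
   = of_real (diag_form y a b c d)"
  unfolding form_defs by simp

text \<open>The given point is the value at parameter \<open>\<i>\<close> of the real line through
  its real parts in the direction of its imaginary parts, so a zero would be a root of the
  restricted quartic at \<open>\<i>\<close>.\<close>

lemma diag_form_nonzero_generic:
  fixes y a b c d :: complex
  assumes pos: "Im y > 0" "Im a > 0" "Im b > 0" "Im c > 0" "Im d > 0"
    and gen: "Re a * Im b \<noteq> Re b * Im a" "Re a * Im c \<noteq> Re c * Im a" "Re a * Im d \<noteq> Re d * Im a"
      "Re b * Im c \<noteq> Re c * Im b" "Re b * Im d \<noteq> Re d * Im b" "Re c * Im d \<noteq> Re d * Im c"
  shows "diag_form y a b c d \<noteq> 0"
proof -
  let ?L = "\<lambda>w t. complex_of_real (Re w) + t * complex_of_real (Im w)"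
  obtain c0 c1 c2 c3 where Q: "\<And>z. diag_form (?L y z) (?L a z) (?L b z) (?L c z) (?L d z) =
      quartic c0 c1 c2 c3 (diag_form (Im y) (Im a) (Im b) (Im c) (Im d)) z"
    using diag_form_line_quartic by blast
  let ?R = "\<lambda>w t. Re w + t * Im w"
  have "diag_form (?L y t) (?L a t) (?L b t) (?L c t) (?L d t) =
      of_real (diag_form (?R y t) (?R a t) (?R b t) (?R c t) (?R d t))" for t :: real
    unfolding diag_form_of_real[symmetric] by simp
  then have Q': "Re (quartic c0 c1 c2 c3 (diag_form (Im y) (Im a) (Im b) (Im c) (Im d)) t) =
      diag_form (?R y t) (?R a t) (?R b t) (?R c t) (?R d t)" for t :: real
    unfolding Q[symmetric] by simp
  obtain t1 t2 t3 where t: "t1 < t2" "t2 < t3"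
    "diag_form (?R y t1) (?R a t1) (?R b t1) (?R c t1) (?R d t1) \<le> 0"
    "diag_form (?R y t2) (?R a t2) (?R b t2) (?R c t2) (?R d t2) \<ge> 0"
    "diag_form (?R y t3) (?R a t3) (?R b t3) (?R c t3) (?R d t3) \<le> 0"
    using diag_form_line_signs[OF pos gen] by blast
  have lead: "diag_form (Im y) (Im a) (Im b) (Im c) (Im d) > 0"
    unfolding form_defs using pos by (intro add_pos_nonneg mult_pos_pos add_pos_pos) auto
  have "?L w \<i> = w" for w by (simp add: complex_eq_iff)
  then show ?thesis
    using Q[of \<i>] quartic_sign_pattern_imp_no_root_ii[OF lead t(1,2), of c0 c1 c2 c3] t(3-5)
    unfolding Q' by simp
qed

section \<open>From generic to arbitrary points with positive imaginary parts\<close>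

text \<open>At a zero u + i v, the vectors u and v are orthogonal for the quadratic form e_2, and
  e_2(u) = e_2(v) > 0. This is impossible because e_2 has only one positive eigenvalue.\<close>

lemma es2_nonzero:
  fixes a b c d :: complex
  assumes pos: "Im a > 0" "Im b > 0" "Im c > 0" "Im d > 0"
  shows "es2 a b c d \<noteq> 0"
proof
  define ua ub uc ud where u: "ua = Re a" "ub = Re b" "uc = Re c" "ud = Re d"
  define va vb vc vd where v: "va = Im a" "vb = Im b" "vc = Im c" "vd = Im d"
  assume "es2 a b c d = 0"
  then have "Re (es2 a b c d) = 0" "Im (es2 a b c d) = 0" by simp_all
  then have re: "es2 ua ub uc ud = es2 va vb vc vd"
    and im: "ua*(vb+vc+vd) + ub*(va+vc+vd) + uc*(va+vb+vd) + ud*(va+vb+vc) = 0"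
    unfolding u v es2_def by (simp_all add: algebra_simps)
  define S T where "S = es1 va vb vc vd" and "T = es1 ua ub uc ud"
  have S: "S > 0" unfolding S_def v es1_def using pos by simp
  \<comment> \<open>The vector S u - T v satisfies e_1 = 0, where 2 e_2 is minus the sum of squares.
    Expanding e_2 bilinearly on it gives the identity.\<close>
  have "2 * (S^2 * es2 ua ub uc ud + T^2 * es2 va vb vc vd) =
     2 * S * T * (ua*(vb+vc+vd) + ub*(va+vc+vd) + uc*(va+vb+vd) + ud*(va+vb+vc))
     - ((S*ua - T*va)^2 + (S*ub - T*vb)^2 + (S*uc - T*vc)^2 + (S*ud - T*vd)^2)"
    unfolding S_def T_def es1_def es2_def by Groebner_Basis.algebra
  then have "S^2 * es2 va vb vc vd + T^2 * es2 va vb vc vd \<le> 0"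
    unfolding im re by (smt (verit) zero_le_power2 mult_zero_right)
  moreover have "es2 va vb vc vd > 0" unfolding v es2_def using pos by (simp add: add_pos_pos)
  then have "S^2 * es2 va vb vc vd > 0" "T^2 * es2 va vb vc vd \<ge> 0" using S by auto
  ultimately show False by linarith
qed

text \<open>Both roots lie in the closed lower half plane, so \<open>y\<close> has distance at least
  Im y from each. Unlike nonvanishing, such an inequality survives a limit.\<close>

lemma quadratic_stable_lower_bound:
  fixes A B C y :: complex
  assumes nz: "\<And>y. Im y > 0 \<Longrightarrow> A*y^2 + B*y + C \<noteq> 0" and y: "Im y > 0"
  shows "cmod A * (Im y)^2 \<le> cmod (A*y^2 + B*y + C)"
proof (cases "A = 0")
  case False
  define s where "s = csqrt (B^2 - 4*A*C)"
  define r1 r2 where r: "r1 = (-B + s) / (2*A)" "r2 = (-B - s) / (2*A)"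
  have s: "s^2 = B^2 - 4*A*C" by (simp add: s_def)
  have sum: "A * (r1 + r2) = - B" using False by (simp add: r field_simps)
  have "4 * A * (A * (r1 * r2)) = (-B + s) * (-B - s)" using False by (simp add: r field_simps)
  also have "\<dots> = 4 * A * C" using s by (simp add: power2_eq_square algebra_simps)
  finally have prod: "A * (r1 * r2) = C" using False by simp
  have factor: "A*x^2 + B*x + C = A * ((x - r1) * (x - r2))" for x
  proof -
    have "A * ((x - r1) * (x - r2)) = A*x^2 - A * (r1 + r2) * x + A * (r1 * r2)"
      by (simp add: algebra_simps power2_eq_square)
    then show ?thesis unfolding sum prod by simp
  qed
  have "Im r1 \<le> 0" "Im r2 \<le> 0" using nz[of r1] nz[of r2] unfolding factor by force+
  then have "Im y \<le> cmod (y - r1)" "Im y \<le> cmod (y - r2)"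
    using abs_Im_le_cmod[of "y - r1"] abs_Im_le_cmod[of "y - r2"] by auto
  then have "(Im y)^2 \<le> cmod (y - r1) * cmod (y - r2)"
    unfolding power2_eq_square using y by (intro mult_mono) auto
  then show ?thesis unfolding factor norm_mult by (simp add: mult_left_mono)
qed simp

lemma eventually_perturbed_nonzero:
  fixes \<alpha> \<beta> :: real
  assumes "\<beta> \<noteq> 0"
  shows "eventually (\<lambda>\<epsilon>. \<alpha> + \<epsilon> * \<beta> \<noteq> 0) (at_right 0)"
proof (cases "\<alpha> = 0")
  case True
  have "eventually (\<lambda>\<epsilon>::real. \<epsilon> > 0) (at_right 0)" by (simp add: eventually_at_right_less)
  then show ?thesis by eventually_elim (use assms True in auto)
next
  case False
  have "((\<lambda>\<epsilon>. \<alpha> + \<epsilon> * \<beta>) \<longlongrightarrow> \<alpha>) (at_right 0)" by (auto intro!: tendsto_eq_intros)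
  then show ?thesis using False by (rule tendsto_imp_eventually_ne)
qed

text \<open>Nearby generic points satisfy \<open>quadratic_stable_lower_bound\<close> in the
  variable \<open>y\<close>, with leading coefficient 4 e_2. The bound passes to the limit and is
  positive there because e_2 has no zero.\<close>

lemma diag_form_nonzero:
  fixes y a b c d :: complex
  assumes pos: "Im y > 0" "Im a > 0" "Im b > 0" "Im c > 0" "Im d > 0"
  shows "diag_form y a b c d \<noteq> 0"
proof -
  \<comment> \<open>The shift is real and proportional to Im w: it keeps the imaginary part and adds
    \<epsilon> k to the ratio of real to imaginary part. The distinct factors 1, 2, 3, 4 separate
    the four ratios for all small positive \<epsilon>.\<close>
  define p where "p = (\<lambda>(k::real) w \<epsilon>. w + complex_of_real (\<epsilon> * k * Im w))"
  have Imp: "Im (p k w \<epsilon>) = Im w" and Rep: "Re (p k w \<epsilon>) = Re w + \<epsilon> * (k * Im w)" for k w \<epsilon>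
    by (simp_all add: p_def)
  have ev: "eventually (\<lambda>\<epsilon>. Re (p k w \<epsilon>) * Im (p l x \<epsilon>) \<noteq> Re (p l x \<epsilon>) * Im (p k w \<epsilon>)) (at_right 0)"
    if "k \<noteq> l" "Im w > 0" "Im x > 0" for k l w x
  proof -
    have "(k - l) * Im w * Im x \<noteq> 0" using that by auto
    from eventually_perturbed_nonzero[OF this, of "Re w * Im x - Re x * Im w"] show ?thesis
      by eventually_elim (simp add: Imp Rep algebra_simps)
  qed
  let ?E2 = "\<lambda>\<epsilon>. es2 (p 1 a \<epsilon>) (p 2 b \<epsilon>) (p 3 c \<epsilon>) (p 4 d \<epsilon>)"
  let ?G = "\<lambda>y \<epsilon>. diag_form y (p 1 a \<epsilon>) (p 2 b \<epsilon>) (p 3 c \<epsilon>) (p 4 d \<epsilon>)"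
  have E: "eventually (\<lambda>\<epsilon>. Re (p 1 a \<epsilon>) * Im (p 2 b \<epsilon>) \<noteq> Re (p 2 b \<epsilon>) * Im (p 1 a \<epsilon>)) (at_right 0)"
    "eventually (\<lambda>\<epsilon>. Re (p 1 a \<epsilon>) * Im (p 3 c \<epsilon>) \<noteq> Re (p 3 c \<epsilon>) * Im (p 1 a \<epsilon>)) (at_right 0)"
    "eventually (\<lambda>\<epsilon>. Re (p 1 a \<epsilon>) * Im (p 4 d \<epsilon>) \<noteq> Re (p 4 d \<epsilon>) * Im (p 1 a \<epsilon>)) (at_right 0)"
    "eventually (\<lambda>\<epsilon>. Re (p 2 b \<epsilon>) * Im (p 3 c \<epsilon>) \<noteq> Re (p 3 c \<epsilon>) * Im (p 2 b \<epsilon>)) (at_right 0)"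
    "eventually (\<lambda>\<epsilon>. Re (p 2 b \<epsilon>) * Im (p 4 d \<epsilon>) \<noteq> Re (p 4 d \<epsilon>) * Im (p 2 b \<epsilon>)) (at_right 0)"
    "eventually (\<lambda>\<epsilon>. Re (p 3 c \<epsilon>) * Im (p 4 d \<epsilon>) \<noteq> Re (p 4 d \<epsilon>) * Im (p 3 c \<epsilon>)) (at_right 0)"
    using pos by (auto intro!: ev)
  have "eventually (\<lambda>\<epsilon>. cmod (4 * ?E2 \<epsilon>) * (Im y)^2 \<le> cmod (?G y \<epsilon>)) (at_right 0)"
    using E
  proof eventually_elim
    case (elim \<epsilon>)
    let ?e1 = "es1 (p 1 a \<epsilon>) (p 2 b \<epsilon>) (p 3 c \<epsilon>) (p 4 d \<epsilon>)"
    let ?e3 = "es3 (p 1 a \<epsilon>) (p 2 b \<epsilon>) (p 3 c \<epsilon>) (p 4 d \<epsilon>)"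
    obtain C where form: "\<And>y. ?G y \<epsilon> = 4 * ?E2 \<epsilon> * y^2 + 4 * (?e1 * ?E2 \<epsilon> + ?e3) * y + C"
    proof
      show "?G y \<epsilon> = 4 * ?E2 \<epsilon> * y^2 + 4 * (?e1 * ?E2 \<epsilon> + ?e3) * y + ?G 0 \<epsilon>" for y
        unfolding diag_form_def by (simp add: algebra_simps power2_eq_square)
    qed
    have "?G y \<epsilon> \<noteq> 0" if "Im y > 0" for y
      using that pos elim by (intro diag_form_nonzero_generic) (unfold Imp)
    from quadratic_stable_lower_bound[OF this[unfolded form] pos(1)] show ?case
      unfolding form[symmetric] .
  qed
  moreover have lim: "((\<lambda>\<epsilon>. p k w \<epsilon>) \<longlongrightarrow> w) (at_right 0)" for k w
    unfolding p_def by (auto intro!: tendsto_eq_intros)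
  have "((\<lambda>\<epsilon>. cmod (4 * ?E2 \<epsilon>) * (Im y)^2) \<longlongrightarrow> cmod (4 * es2 a b c d) * (Im y)^2) (at_right 0)"
    unfolding es2_def by (intro tendsto_intros lim)
  moreover have "((\<lambda>\<epsilon>. cmod (?G y \<epsilon>)) \<longlongrightarrow> cmod (diag_form y a b c d)) (at_right 0)"
    unfolding form_defs by (intro tendsto_intros lim)
  ultimately have "cmod (4 * es2 a b c d) * (Im y)^2 \<le> cmod (diag_form y a b c d)"
    by (intro tendsto_le[OF trivial_limit_at_right_real])
  moreover have "cmod (4 * es2 a b c d) * (Im y)^2 > 0" using es2_nonzero[OF pos(2-)] pos by simp
  ultimately show ?thesis by auto
qed

section \<open>Equating the two variables of a pair\<close>

text \<open>If equality held, the product of the imaginary parts would exceed (Im \<delta>)^2, and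
  by comparing real parts the product of the real parts would exceed (Re \<delta>)^2. The
  arithmetic-geometric mean inequality for the two terms of Im (X Y) contradicts this.\<close>

lemma no_geometric_mean_above_strip:
  fixes X Y \<delta> :: complex
  assumes "\<bar>Im \<delta>\<bar> < Im X" "\<bar>Im \<delta>\<bar> < Im Y"
  shows "X * Y \<noteq> \<delta>^2"
proof
  assume eq: "X * Y = \<delta>^2"
  define a b c e p q where d: "a = Re X" "b = Im X" "c = Re Y" "e = Im Y" "p = Re \<delta>" "q = Im \<delta>"
  have re: "a*c - b*e = p^2 - q^2" and im: "a*e + b*c = 2*p*q"
    using eq unfolding d by (auto simp: complex_eq_iff power2_eq_square)
  have be: "b*e > q^2"
  proof -
    have "\<bar>q\<bar> * \<bar>q\<bar> < b * e" using assms unfolding d by (intro mult_strict_mono') auto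
    then show ?thesis by (simp add: power2_eq_square)
  qed
  then have ac: "a*c > p^2" using re by linarith
  have "p^2 * q^2 < (a*c) * (b*e)" using ac be by (intro mult_strict_mono') auto
  moreover have "4 * ((a*c) * (b*e)) = (a*e + b*c)^2 - (a*e - b*c)^2"
    by Groebner_Basis.algebra
  moreover have "(2*p*q)^2 = 4 * (p^2 * q^2)" by Groebner_Basis.algebra
  moreover have "(a*e - b*c)^2 \<ge> 0" by simp
  ultimately show False unfolding im by linarith
qed

text \<open>For \<gamma> nonzero the equation reads (x - h) (y - h) = \<delta>^2, with diagonal
  solutions h + \<delta> and h - \<delta>. If neither were in the upper half plane, then |Im
  \<delta>| \<le> - Im h, which puts x - h and y - h above the strip of the preceding lemma. For
  \<gamma> = 0 the midpoint works.\<close>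

lemma diagonal_root_of_symmetric_biaffine:
  fixes \<alpha> \<beta> \<gamma> x y :: complex
  assumes xy: "Im x > 0" "Im y > 0" and zero: "\<alpha> + \<beta> * (x + y) + \<gamma> * (x * y) = 0"
  shows "\<exists>z. Im z > 0 \<and> \<alpha> + \<beta> * (2 * z) + \<gamma> * z^2 = 0"
proof (cases "\<gamma> = 0")
  case True
  have "2 * ((x + y) / 2) = x + y" by simp
  then show ?thesis using xy zero True by (intro exI[of _ "(x + y) / 2"]) (simp del: distrib_left_numeral)
next
  case False
  define h where "h = - \<beta> / \<gamma>"
  define \<delta> where "\<delta> = csqrt (h^2 - \<alpha> / \<gamma>)"
  have \<beta>: "\<beta> = - (\<gamma> * h)" using False by (simp add: h_def)
  have d2: "\<delta>^2 = h^2 - \<alpha> / \<gamma>" by (simp add: \<delta>_def)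
  have \<alpha>: "\<alpha> = \<gamma> * (h^2 - \<delta>^2)" using False unfolding d2 by simp
  have "\<gamma> * ((x - h) * (y - h) - \<delta>^2) = 0"
    using zero unfolding \<alpha> \<beta> by (simp add: algebra_simps power2_eq_square)
  then have eq: "(x - h) * (y - h) = \<delta>^2" using False by simp
  have root: "\<alpha> + \<beta> * (2 * z) + \<gamma> * z^2 = \<gamma> * ((z - h)^2 - \<delta>^2)" for z
    unfolding \<alpha> \<beta> by (simp add: algebra_simps power2_eq_square)
  show ?thesis
  proof (rule ccontr)
    assume "\<not> ?thesis"
    then have no: "\<not> Im z > 0" if "(z - h)^2 = \<delta>^2" for z
      using that unfolding root by auto
    have "\<not> Im (h + \<delta>) > 0" "\<not> Im (h - \<delta>) > 0" by (intro no; simp)+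
    then have "\<bar>Im \<delta>\<bar> < Im (x - h)" "\<bar>Im \<delta>\<bar> < Im (y - h)" using xy by auto
    from no_geometric_mean_above_strip[OF this] eq show False by simp
  qed
qed

section \<open>The generating polynomial in terms of pair sums and products\<close>

text \<open>The basis generating polynomial of a uniform matroid. Its recursion avoids listing all
  210 four-element subsets.\<close>

definition esym :: "nat set \<Rightarrow> nat \<Rightarrow> (nat \<Rightarrow> 'a::comm_ring_1) \<Rightarrow> 'a" where
  "esym A n x = (\<Sum>B\<in>{B. B \<subseteq> A \<and> card B = n}. \<Prod>i\<in>B. x i)"

lemma esym_0: "finite A \<Longrightarrow> esym A 0 x = 1"
proof -
  assume "finite A"
  then have "{B. B \<subseteq> A \<and> card B = 0} = {{}}" by (auto dest: finite_subset)
  then show ?thesis by (simp add: esym_def)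
qed

lemma esym_empty_Suc: "esym {} (Suc n) x = 0"
proof -
  have "{B::nat set. B \<subseteq> {} \<and> card B = Suc n} = {}" by auto
  then show ?thesis unfolding esym_def by (simp only: sum.empty)
qed

lemma esym_insert:
  assumes "finite A" "a \<notin> A"
  shows "esym (insert a A) (Suc n) x = esym A (Suc n) x + x a * esym A n x"
proof -
  let ?S = "\<lambda>n. {B. B \<subseteq> A \<and> card B = n}"
  have fin: "finite B" if "B \<subseteq> A" for B using that assms(1) finite_subset by blast
  have split: "{B. B \<subseteq> insert a A \<and> card B = Suc n} = ?S (Suc n) \<union> insert a ` ?S n" (is "?L = ?R")
  proof
    show "?L \<subseteq> ?R"
    proof
      fix B assume B: "B \<in> ?L"
      then have "finite B" using assms(1) by (auto intro: finite_subset)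
      show "B \<in> ?R"
      proof (cases "a \<in> B")
        case True
        then have "B = insert a (B - {a})" "B - {a} \<in> ?S n" using B \<open>finite B\<close> by auto
        then show ?thesis by blast
      qed (use B in auto)
    qed
    show "?R \<subseteq> ?L" using assms fin by (auto simp: card_insert_if)
  qed
  have inj: "inj_on (insert a) (?S n)" using assms(2) by (auto simp: inj_on_def)
  have "(\<Sum>B\<in>insert a ` ?S n. \<Prod>i\<in>B. x i) = (\<Sum>B\<in>?S n. \<Prod>i\<in>insert a B. x i)"
    by (simp add: sum.reindex[OF inj])
  also have "\<dots> = (\<Sum>B\<in>?S n. x a * (\<Prod>i\<in>B. x i))"
    using fin assms(2) by (intro sum.cong refl prod.insert) auto
  finally have "(\<Sum>B\<in>insert a ` ?S n. \<Prod>i\<in>B. x i) = x a * esym A n x"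
    by (simp add: esym_def sum_distrib_left)
  moreover have "?S (Suc n) \<inter> insert a ` ?S n = {}" using assms(2) by auto
  ultimately show ?thesis
    unfolding esym_def split using assms(1) by (subst sum.union_disjoint) (auto simp: esym_def)
qed

text \<open>Two new elements enter only through sum and product: the generating series is multiplied
  by 1 + (x_a + x_b) t + x_a x_b t^2.\<close>

lemma esym_insert_pair:
  assumes "finite A" "a \<notin> A" "b \<notin> A" "a \<noteq> b"
  shows "esym (insert a (insert b A)) (Suc 0) x = esym A (Suc 0) x + (x a + x b)"
    and "esym (insert a (insert b A)) (Suc (Suc n)) x =
      esym A (Suc (Suc n)) x + (x a + x b) * esym A (Suc n) x + x a * x b * esym A n x"
  using assms by (simp_all add: esym_insert esym_0 algebra_simps)

text \<open>The coefficient of t^4 in the product of the five factors 1 + s_j t + p_j t^2, without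
  the seven products p_i p_j that belong to excluded sets; three of the ten remain.\<close>

definition pair_form :: "'a::comm_ring_1 \<Rightarrow> 'a \<Rightarrow> 'a \<Rightarrow> 'a \<Rightarrow> 'a \<Rightarrow> 'a \<Rightarrow> 'a \<Rightarrow> 'a \<Rightarrow> 'a \<Rightarrow> 'a \<Rightarrow> 'a" where
  "pair_form s1 p1 s2 p2 s3 p3 s4 p4 s5 p5 =
     s2*s3*s4*s5 + s1 * es3 s2 s3 s4 s5 + p1 * es2 s2 s3 s4 s5 + p2 * es2 s1 s3 s4 s5
     + p3 * es2 s1 s2 s4 s5 + p4 * es2 s1 s2 s3 s5 + p5 * es2 s1 s2 s3 s4
     + (p2*p4 + p2*p5 + p3*p5)"

lemma basis_gen_poly_V10:
  "basis_gen_poly V10_bases x = pair_form (x 1 + x 2) (x 1 * x 2) (x 3 + x 4) (x 3 * x 4)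
     (x 5 + x 6) (x 5 * x 6) (x 7 + x 8) (x 7 * x 8) (x 9 + x 10) (x 9 * x 10)"
proof -
  let ?S = "{B. B \<subseteq> {1..10::nat} \<and> card B = 4}"
  let ?C = "{{1,2,3,4}, {1,2,5,6}, {1,2,7,8}, {1,2,9,10}, {3,4,5,6}, {5,6,7,8}, {7,8,9,10}} :: nat set set"
  have "?C \<subseteq> ?S" by simp
  then have "basis_gen_poly V10_bases x = esym {1..10} 4 x - (\<Sum>B\<in>?C. \<Prod>i\<in>B. x i)"
    unfolding basis_gen_poly_def V10_bases_def esym_def by (intro sum_diff) auto
  also have "(\<Sum>B\<in>?C. \<Prod>i\<in>B. x i) = x 1*x 2*(x 3*x 4) + x 1*x 2*(x 5*x 6) + x 1*x 2*(x 7*x 8) + x 1*x 2*(x 9*x 10)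
     + x 3*x 4*(x 5*x 6) + x 5*x 6*(x 7*x 8) + x 7*x 8*(x 9*x 10)"
    by (simp add: set_eq_subset mult.assoc add.assoc)
  also have "{1..10::nat} = insert 1 (insert 2 (insert 3 (insert 4 (insert 5 (insert 6 (insert 7 (insert 8 (insert 9 (insert 10 {})))))))))"
    by (auto; presburger)
  also have "esym \<dots> 4 x - (x 1*x 2*(x 3*x 4) + x 1*x 2*(x 5*x 6) + x 1*x 2*(x 7*x 8) + x 1*x 2*(x 9*x 10)
     + x 3*x 4*(x 5*x 6) + x 5*x 6*(x 7*x 8) + x 7*x 8*(x 9*x 10)) = pair_form (x 1 + x 2) (x 1 * x 2) (x 3 + x 4) (x 3 * x 4)
     (x 5 + x 6) (x 5 * x 6) (x 7 + x 8) (x 7 * x 8) (x 9 + x 10) (x 9 * x 10)"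
  proof -
    define s1 s2 s3 s4 s5 where s: "s1 = x 1 + x 2" "s2 = x 3 + x 4" "s3 = x 5 + x 6" "s4 = x 7 + x 8" "s5 = x 9 + x 10"
    define p1 p2 p3 p4 p5 where p: "p1 = x 1 * x 2" "p2 = x 3 * x 4" "p3 = x 5 * x 6" "p4 = x 7 * x 8" "p5 = x 9 * x 10"
    have 4: "4 = Suc (Suc (Suc (Suc 0)))" by simp
    show ?thesis
      unfolding 4
      apply (simp add: esym_insert_pair esym_0 esym_empty_Suc s[symmetric] p[symmetric] del: One_nat_def)
      unfolding s[symmetric] p[symmetric] pair_form_def es2_def es3_def
      by (simp add: algebra_simps)
  qed
  finally show ?thesis .
qed

lemma pair_form_diagonal:
  "pair_form (2*y) (y^2) (2*a) (a^2) (2*b) (b^2) (2*c) (c^2) (2*d) (d^2) = diag_form y a b c d"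
  for y a b c d :: complex
  unfolding pair_form_def form_defs by Groebner_Basis.algebra

lemma pair_form_nonzero:
  fixes x :: "nat \<Rightarrow> complex"
  assumes pos: "\<And>i. i \<in> {1..10} \<Longrightarrow> Im (x i) > 0"
  shows "pair_form (x 1 + x 2) (x 1 * x 2) (x 3 + x 4) (x 3 * x 4)
     (x 5 + x 6) (x 5 * x 6) (x 7 + x 8) (x 7 * x 8) (x 9 + x 10) (x 9 * x 10) \<noteq> 0" (is "?F \<noteq> 0")
proof
  have P: "Im (x 1) > 0" "Im (x 2) > 0" "Im (x 3) > 0" "Im (x 4) > 0" "Im (x 5) > 0"
     "Im (x 6) > 0" "Im (x 7) > 0" "Im (x 8) > 0" "Im (x 9) > 0" "Im (x 10) > 0"
    by (auto intro!: pos)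
  \<comment> \<open>The affine function \<open>f\<close> is given by its values at (0,0), (1,0) and
    (0,1). Applied to one pair after the other, this moves a zero to one with equal variables in
    every pair.\<close>
  have step: "\<exists>z. Im z > 0 \<and> f (2 * z) (z^2) = 0"
    if f: "\<And>s p. f s p = f 0 0 + (f 1 0 - f 0 0) * s + (f 0 1 - f 0 0) * p"
      and "Im u > 0" "Im v > 0" "f (u + v) (u * v) = 0" for f :: "complex \<Rightarrow> complex \<Rightarrow> complex" and u v
  proof -
    have "f 0 0 + (f 1 0 - f 0 0) * (u + v) + (f 0 1 - f 0 0) * (u * v) = 0"
      using f[of "u + v" "u * v"] that(4) by simp
    from diagonal_root_of_symmetric_biaffine[OF that(2,3) this]
    obtain z where "Im z > 0" "f 0 0 + (f 1 0 - f 0 0) * (2 * z) + (f 0 1 - f 0 0) * z^2 = 0" by blast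
    then show ?thesis using f[of "2 * z" "z^2"] by auto
  qed
  assume "?F = 0"
  note zero = this
  have affine:
    "pair_form s p s2 p2 s3 p3 s4 p4 s5 p5 = pair_form 0 0 s2 p2 s3 p3 s4 p4 s5 p5 + (pair_form 1 0 s2 p2 s3 p3 s4 p4 s5 p5 - pair_form 0 0 s2 p2 s3 p3 s4 p4 s5 p5) * s + (pair_form 0 1 s2 p2 s3 p3 s4 p4 s5 p5 - pair_form 0 0 s2 p2 s3 p3 s4 p4 s5 p5) * p"
    "pair_form s1 p1 s p s3 p3 s4 p4 s5 p5 = pair_form s1 p1 0 0 s3 p3 s4 p4 s5 p5 + (pair_form s1 p1 1 0 s3 p3 s4 p4 s5 p5 - pair_form s1 p1 0 0 s3 p3 s4 p4 s5 p5) * s + (pair_form s1 p1 0 1 s3 p3 s4 p4 s5 p5 - pair_form s1 p1 0 0 s3 p3 s4 p4 s5 p5) * p"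
    "pair_form s1 p1 s2 p2 s p s4 p4 s5 p5 = pair_form s1 p1 s2 p2 0 0 s4 p4 s5 p5 + (pair_form s1 p1 s2 p2 1 0 s4 p4 s5 p5 - pair_form s1 p1 s2 p2 0 0 s4 p4 s5 p5) * s + (pair_form s1 p1 s2 p2 0 1 s4 p4 s5 p5 - pair_form s1 p1 s2 p2 0 0 s4 p4 s5 p5) * p"
    "pair_form s1 p1 s2 p2 s3 p3 s p s5 p5 = pair_form s1 p1 s2 p2 s3 p3 0 0 s5 p5 + (pair_form s1 p1 s2 p2 s3 p3 1 0 s5 p5 - pair_form s1 p1 s2 p2 s3 p3 0 0 s5 p5) * s + (pair_form s1 p1 s2 p2 s3 p3 0 1 s5 p5 - pair_form s1 p1 s2 p2 s3 p3 0 0 s5 p5) * p"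
    "pair_form s1 p1 s2 p2 s3 p3 s4 p4 s p = pair_form s1 p1 s2 p2 s3 p3 s4 p4 0 0 + (pair_form s1 p1 s2 p2 s3 p3 s4 p4 1 0 - pair_form s1 p1 s2 p2 s3 p3 s4 p4 0 0) * s + (pair_form s1 p1 s2 p2 s3 p3 s4 p4 0 1 - pair_form s1 p1 s2 p2 s3 p3 s4 p4 0 0) * p"
    for s p s1 p1 s2 p2 s3 p3 s4 p4 s5 p5 :: complex
    unfolding pair_form_def es2_def es3_def by Groebner_Basis.algebra+
  from step[of "\<lambda>s p. pair_form s p (x 3 + x 4) (x 3 * x 4) (x 5 + x 6) (x 5 * x 6) (x 7 + x 8) (x 7 * x 8) (x 9 + x 10) (x 9 * x 10)", OF affine(1) P(1,2) zero]
  obtain y where y: "Im y > 0" "pair_form (2*y) (y^2) (x 3 + x 4) (x 3 * x 4) (x 5 + x 6) (x 5 * x 6) (x 7 + x 8) (x 7 * x 8) (x 9 + x 10) (x 9 * x 10) = 0" by blast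
  from step[of "\<lambda>s p. pair_form (2*y) (y^2) s p (x 5 + x 6) (x 5 * x 6) (x 7 + x 8) (x 7 * x 8) (x 9 + x 10) (x 9 * x 10)", OF affine(2) P(3,4) y(2)]
  obtain a where a: "Im a > 0" "pair_form (2*y) (y^2) (2*a) (a^2) (x 5 + x 6) (x 5 * x 6) (x 7 + x 8) (x 7 * x 8) (x 9 + x 10) (x 9 * x 10) = 0" by blast
  from step[of "\<lambda>s p. pair_form (2*y) (y^2) (2*a) (a^2) s p (x 7 + x 8) (x 7 * x 8) (x 9 + x 10) (x 9 * x 10)", OF affine(3) P(5,6) a(2)]
  obtain b where b: "Im b > 0" "pair_form (2*y) (y^2) (2*a) (a^2) (2*b) (b^2) (x 7 + x 8) (x 7 * x 8) (x 9 + x 10) (x 9 * x 10) = 0" by blast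
  from step[of "\<lambda>s p. pair_form (2*y) (y^2) (2*a) (a^2) (2*b) (b^2) s p (x 9 + x 10) (x 9 * x 10)", OF affine(4) P(7,8) b(2)]
  obtain c where c: "Im c > 0" "pair_form (2*y) (y^2) (2*a) (a^2) (2*b) (b^2) (2*c) (c^2) (x 9 + x 10) (x 9 * x 10) = 0" by blast
  from step[of "\<lambda>s p. pair_form (2*y) (y^2) (2*a) (a^2) (2*b) (b^2) (2*c) (c^2) s p", OF affine(5) P(9,10) c(2)]
  obtain d where d: "Im d > 0" "pair_form (2*y) (y^2) (2*a) (a^2) (2*b) (b^2) (2*c) (c^2) (2*d) (d^2) = 0" by blast
  show False
    using diag_form_nonzero[OF y(1) a(1) b(1) c(1) d(1)] d(2) unfolding pair_form_diagonal by simp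
qed

lemma map_poly_of_real_basis_gen_poly_line:
  fixes v w :: "nat \<Rightarrow> real"
  shows "poly (map_poly complex_of_real (basis_gen_poly \<B> (\<lambda>i. [:w i, v i:]))) z =
     basis_gen_poly \<B> (\<lambda>i. of_real (w i) + z * of_real (v i))"
proof -
  have line: "poly (map_poly complex_of_real [:a, b:]) z = of_real a + z * of_real b" for a b
    by (simp add: Polynomial.map_poly_pCons)
  interpret map_poly_comm_ring_hom complex_of_real ..
  show ?thesis unfolding basis_gen_poly_def
    by (simp add: hom_sum hom_prod poly_sum poly_prod line)
qed

lemma basis_gen_poly_cnj: "basis_gen_poly \<B> (\<lambda>i. cnj (x i)) = cnj (basis_gen_poly \<B> x)"
  by (simp add: basis_gen_poly_def)

lemma half_plane_property_V10: "half_plane_property {1..10} V10_bases"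
  unfolding half_plane_property_def
proof (intro allI impI)
  fix v w :: "nat \<Rightarrow> real" and z :: complex
  assume v: "\<forall>i\<in>{1..10}. 0 < v i"
  let ?f = "\<lambda>z. basis_gen_poly V10_bases (\<lambda>i. of_real (w i) + z * of_real (v i)) :: complex"
  assume "poly (map_poly complex_of_real (basis_gen_poly V10_bases (\<lambda>i. [:w i, v i:]))) z = 0"
  then have z: "?f z = 0" by (simp add: map_poly_of_real_basis_gen_poly_line)
  \<comment> \<open>For Im t > 0 all coordinates w_i + t v_i have positive imaginary part. Roots in
    the lower half plane are then excluded by conjugation.\<close>
  have nz: "?f t \<noteq> 0" if "Im t > 0" for t
    unfolding basis_gen_poly_V10 using v that by (intro pair_form_nonzero) auto
  have "?f (cnj z) = 0" using basis_gen_poly_cnj[of V10_bases "\<lambda>i. of_real (w i) + z * of_real (v i)"] z by simp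
  with z nz[of z] nz[of "cnj z"] have "Im z = 0" by force
  then show "z \<in> \<real>" by (simp add: complex_is_Real_iff)
qed

section \<open>The matroid axioms\<close>

definition V10_circuit_hyperplanes :: "nat set set" where
  "V10_circuit_hyperplanes = {{1,2,3,4}, {1,2,5,6}, {1,2,7,8}, {1,2,9,10}, {3,4,5,6}, {5,6,7,8}, {7,8,9,10}}"

lemma V10_bases_iff: "B \<in> V10_bases \<longleftrightarrow> B \<subseteq> {1..10} \<and> card B = 4 \<and> B \<notin> V10_circuit_hyperplanes"
  unfolding V10_bases_def V10_circuit_hyperplanes_def Diff_iff mem_Collect_eq by (rule conj_assoc)

text \<open>Each of the seven sets is a union of two of the five pairs, so distinct ones share at
  most one pair. This is the sparse paving condition behind basis exchange.\<close>

lemma card_Int_V10_circuit_hyperplanes: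
  assumes "X \<in> V10_circuit_hyperplanes" "Y \<in> V10_circuit_hyperplanes" "X \<noteq> Y"
  shows "card (X \<inter> Y) \<le> 2"
  using assms unfolding V10_circuit_hyperplanes_def insert_iff empty_iff
  by (elim disjE) (simp_all add: card_insert_if)

text \<open>If no exchange for \<open>x\<close> exists, every \<open>y\<close> in B2 - B1 completes
  B1 - {x} to an excluded set. Two such \<open>y\<close> give excluded sets sharing three elements;
  a single one gives B2 itself.\<close>

lemma matroid_bases_V10: "matroid_bases {1..10} V10_bases"
proof -
  have "\<exists>y\<in>B2 - B1. insert y (B1 - {x}) \<in> V10_bases"
    if B: "B1 \<in> V10_bases" "B2 \<in> V10_bases" and x: "x \<in> B1 - B2" for B1 B2 x
  proof (rule ccontr)
    assume "\<not> ?thesis"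
    then have no: "insert y (B1 - {x}) \<notin> V10_bases" if "y \<in> B2 - B1" for y using that by blast
    note B' = B[unfolded V10_bases_iff]
    have fin: "finite B1" "finite B2" using B' by (auto intro: finite_subset)
    have c3: "card (B1 - {x}) = 3" using B' x fin by simp
    have "insert y (B1 - {x}) \<subseteq> {1..10} \<and> card (insert y (B1 - {x})) = 4" if "y \<in> B2 - B1" for y
      using that B' c3 fin by auto
    then have C: "insert y (B1 - {x}) \<in> V10_circuit_hyperplanes" if "y \<in> B2 - B1" for y
      using no[OF that] that unfolding V10_bases_iff by blast
    have "card (B2 - B1) = card (B1 - B2)"
      using B' fin by (simp add: card_Diff_subset_Int Int_commute)
    then have "B2 - B1 \<noteq> {}" using x fin by (metis card_eq_0_iff empty_iff finite_Diff)
    then obtain y where y: "y \<in> B2 - B1" by blast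
    show False
    proof (cases "B2 - B1 = {y}")
      case True
      then have "card (B1 - B2) = 1" using \<open>card (B2 - B1) = card (B1 - B2)\<close> by simp
      then have "B1 - B2 = {x}" using x by (metis card_1_singletonE singletonD)
      then have "insert y (B1 - {x}) = B2" using True by blast
      then show False using no[OF y] B(2) by simp
    next
      case False
      then obtain y' where y': "y' \<in> B2 - B1" "y' \<noteq> y" using y by blast
      have "insert y (B1 - {x}) \<noteq> insert y' (B1 - {x})" using y y' by blast
      from card_Int_V10_circuit_hyperplanes[OF C[OF y] C[OF y'(1)] this]
      have "card (insert y (B1 - {x}) \<inter> insert y' (B1 - {x})) \<le> 2" .
      moreover have "card (B1 - {x}) \<le> card (insert y (B1 - {x}) \<inter> insert y' (B1 - {x}))"
        using fin by (intro card_mono) auto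
      ultimately show False using c3 by simp
    qed
  qed
  moreover have "{1,2,3,5} \<in> V10_bases" unfolding V10_bases_iff V10_circuit_hyperplanes_def by (simp add: set_eq_subset)
  then have "V10_bases \<noteq> {}" by blast
  moreover have "\<forall>B\<in>V10_bases. B \<subseteq> {1..10}" using V10_bases_iff by blast
  ultimately show ?thesis unfolding matroid_bases_def by (intro conjI ballI finite_atLeastAtMost) blast+
qed

section \<open>Subspaces of finite-dimensional spaces\<close>

context vector_space
begin

text \<open>The ambient space may be infinite-dimensional, as the function space below is; the
  finite set \<open>F\<close> is what makes bases of \<open>V\<close> finite.\<close>

lemma basis_extend_finite:
  assumes "B0 \<subseteq> V" "independent B0" "V \<subseteq> span F" "finite F"
  obtains B where "B0 \<subseteq> B" "B \<subseteq> V" "independent B" "V \<subseteq> span B" "finite B" "card B = dim V"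
proof -
  obtain B where B: "B0 \<subseteq> B" "B \<subseteq> V" "independent B" "V \<subseteq> span B"
    using maximal_independent_subset_extend[OF assms(1,2)] by blast
  have "finite B"
    using independent_span_bound[OF assms(4) B(3) order_trans[OF B(2) assms(3)]] by (rule conjunct1)
  show thesis
    by (rule that[OF B \<open>finite B\<close> basis_card_eq_dim[OF B(2,4,3)]])
qed

lemma dim_mono_finite:
  assumes "U \<subseteq> V" "V \<subseteq> span F" "finite F"
  shows "dim U \<le> dim V"
proof -
  obtain B where B: "V \<subseteq> span B" "finite B" "card B = dim V"
    by (rule basis_extend_finite[OF empty_subsetI independent_empty assms(2,3)])
  have "dim U \<le> card B" by (rule dim_le_card[OF order_trans[OF assms(1) B(1)] B(2)])
  then show ?thesis unfolding B(3) .
qed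

lemma dim_sums_Int_finite:
  assumes sub: "subspace U" "subspace V" and F: "U \<subseteq> span F" "V \<subseteq> span F" "finite F"
  shows "dim {x + y |x y. x \<in> U \<and> y \<in> V} + dim (U \<inter> V) = dim U + dim V"
proof -
  have "U \<inter> V \<subseteq> span F" using F by blast
  obtain B0 where B0: "B0 \<subseteq> U \<inter> V" "independent B0" "U \<inter> V \<subseteq> span B0" "finite B0" "card B0 = dim (U \<inter> V)"
    by (rule basis_extend_finite[OF empty_subsetI independent_empty \<open>U \<inter> V \<subseteq> span F\<close> F(3)])
  have "B0 \<subseteq> U" "B0 \<subseteq> V" using B0(1) by auto
  obtain B1 where B1: "B0 \<subseteq> B1" "B1 \<subseteq> U" "independent B1" "U \<subseteq> span B1" "finite B1" "card B1 = dim U"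
    by (rule basis_extend_finite[OF \<open>B0 \<subseteq> U\<close> B0(2) F(1,3)])
  obtain B2 where B2: "B0 \<subseteq> B2" "B2 \<subseteq> V" "independent B2" "V \<subseteq> span B2" "finite B2" "card B2 = dim V"
    by (rule basis_extend_finite[OF \<open>B0 \<subseteq> V\<close> B0(2) F(2,3)])
  have spU: "span B1 = U" and spV: "span B2 = V"
    using B1 B2 sub span_subspace by blast+
  \<comment> \<open>Vectors of B2 - B0 are added one at a time. If b = u + c with u in U and c in
    the span of those already added, then u lies in U \<inter> V, hence in the span of B0, so b
    depends on other vectors of B2.\<close>
  have indep: "independent (B1 \<union> C) \<and> B1 \<inter> C = {}" if "finite C" "C \<subseteq> B2 - B0" for C
    using that
  proof (induction C)
    case empty
    then show ?case using B1 by simp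
  next
    case (insert b C)
    have b: "b \<in> B2" "b \<notin> B0" "b \<notin> C" using insert by auto
    have "b \<notin> span (B1 \<union> C)"
    proof
      assume "b \<in> span (B1 \<union> C)"
      then obtain u c where uc: "b = u + c" "u \<in> span B1" "c \<in> span C"
        unfolding span_Un by blast
      have "c \<in> V" using uc(3) insert.prems span_mono[of C B2] spV by auto
      moreover have "b \<in> V" using b B2 by blast
      ultimately have "u \<in> V" using uc(1) sub(2) by (metis add_diff_cancel_right' subspace_diff)
      then have "u \<in> span B0" using uc(2) spU B0(3) by blast
      then have "b \<in> span (B0 \<union> C)" unfolding uc(1) by (intro span_add) (use uc(3) span_mono[of B0 "B0 \<union> C"] span_mono[of C "B0 \<union> C"] in auto)
      moreover have "B0 \<union> C \<subseteq> B2 - {b}" using b B2(1) insert.prems by auto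
      ultimately have "b \<in> span (B2 - {b})" using span_mono by blast
      then show False using B2(3) b(1) dependent_def by blast
    qed
    then show ?case using insert independent_insertI[of b "B1 \<union> C"] span_base[of b "B1 \<union> C"] by auto
  qed
  define B where "B = B1 \<union> (B2 - B0)"
  have "finite (B2 - B0)" using B2(5) by simp
  then have iB: "independent B" and disj: "B1 \<inter> (B2 - B0) = {}"
    unfolding B_def using indep[OF _ order_refl] by blast+
  have "B = B1 \<union> B2" unfolding B_def using B1(1) by blast
  then have "{x + y |x y. x \<in> U \<and> y \<in> V} = span B"
    using span_Un[of B1 B2] unfolding spU spV by (simp only:)
  then have "dim {x + y |x y. x \<in> U \<and> y \<in> V} = card B"
    using dim_span_eq_card_independent[OF iB] by (simp only:)
  also have "\<dots> = card B1 + card (B2 - B0)"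
    unfolding B_def using disj B1(5) B2(5) by (intro card_Un_disjoint) auto
  also have "card (B2 - B0) = card B2 - card B0" using B2(1) B0(4) by (simp add: card_Diff_subset)
  finally show ?thesis using B0(5) B1(6) B2(6) card_mono[OF B2(5,1)] by linarith
qed

end

section \<open>The coordinate space C^d\<close>

text \<open>Vectors are functions on \<open>nat\<close>, with \<open>cvecs d\<close> as the copy of
  C^d, so that the size \<open>d\<close> obtained inside a proof does not enter a type.\<close>

definition cscale :: "complex \<Rightarrow> (nat \<Rightarrow> complex) \<Rightarrow> nat \<Rightarrow> complex" where
  "cscale c f = (\<lambda>i. c * f i)"

interpretation cfun: vector_space cscale
  by unfold_locales (auto simp: cscale_def fun_eq_iff algebra_simps)

lemma sum_fun_apply: "(\<Sum>j\<in>A. f j) x = (\<Sum>j\<in>A. f j x)" for f :: "'a \<Rightarrow> nat \<Rightarrow> complex"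
  by (induction A rule: infinite_finite_induct) auto

definition cvecs :: "nat \<Rightarrow> (nat \<Rightarrow> complex) set" where
  "cvecs d = {y. \<forall>i\<ge>d. y i = 0}"

definition cunit :: "nat \<Rightarrow> nat \<Rightarrow> complex" where
  "cunit i = (\<lambda>j. if j = i then 1 else 0)"

lemma cvecs_expand: "y \<in> cvecs d \<Longrightarrow> y = (\<Sum>i<d. cscale (y i) (cunit i))"
  by (auto simp: cvecs_def fun_eq_iff sum_fun_apply cscale_def cunit_def if_distrib sum.delta cong: if_cong)

lemma subspace_cvecs: "cfun.subspace (cvecs d)"
  by (auto simp: cfun.subspace_def cvecs_def cscale_def)

lemma cvecs_subset_span_cunit: "cvecs d \<subseteq> cfun.span (cunit ` {..<d})"
proof
  fix y assume "y \<in> cvecs d"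
  then have "y = (\<Sum>i<d. cscale (y i) (cunit i))" by (rule cvecs_expand)
  also have "\<dots> \<in> cfun.span (cunit ` {..<d})"
    by (intro cfun.span_sum cfun.span_scale cfun.span_base) auto
  finally show "y \<in> cfun.span (cunit ` {..<d})" .
qed

lemma inj_cunit: "inj cunit"
  by (auto simp: inj_def cunit_def fun_eq_iff)

lemma dim_cvecs: "cfun.dim (cvecs d) = d"
proof -
  have "cfun.independent (cunit ` {..<d})"
  proof (rule cfun.independent_if_scalars_zero)
    fix f x assume s: "(\<Sum>x\<in>cunit ` {..<d}. cscale (f x) x) = 0" and "x \<in> cunit ` {..<d}"
    then obtain i where i: "i < d" "x = cunit i" by auto
    have "(\<Sum>j<d. cscale (f (cunit j)) (cunit j)) = 0"
      using s by (subst (asm) sum.reindex) (auto intro: inj_on_subset[OF inj_cunit])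
    then have "(\<Sum>j<d. cscale (f (cunit j)) (cunit j)) i = 0" by simp
    then show "f x = 0" using i
      by (simp add: sum_fun_apply cscale_def cunit_def if_distrib sum.delta cong: if_cong)
  qed simp
  moreover have "cunit ` {..<d} \<subseteq> cvecs d" by (auto simp: cvecs_def cunit_def)
  ultimately have "card (cunit ` {..<d}) = cfun.dim (cvecs d)"
    by (intro cfun.basis_card_eq_dim cvecs_subset_span_cunit)
  then show ?thesis by (simp add: card_image[OF inj_on_subset[OF inj_cunit subset_UNIV]])
qed

lemma dim_Int_sum_cvecs:
  assumes "cfun.subspace U" "cfun.subspace V" "U \<subseteq> cvecs d" "V \<subseteq> cvecs d"
  shows "cfun.dim {x + y |x y. x \<in> U \<and> y \<in> V} + cfun.dim (U \<inter> V) = cfun.dim U + cfun.dim V"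
  by (rule cfun.dim_sums_Int_finite[OF assms(1,2) order_trans[OF assms(3) cvecs_subset_span_cunit]
      order_trans[OF assms(4) cvecs_subset_span_cunit] finite_imageI[OF finite_lessThan]])

lemma dim_mono_cvecs:
  assumes "U \<subseteq> V" "V \<subseteq> cvecs d"
  shows "cfun.dim U \<le> cfun.dim V"
  by (rule cfun.dim_mono_finite[OF assms(1) order_trans[OF assms(2) cvecs_subset_span_cunit]
      finite_imageI[OF finite_lessThan]])

text \<open>Since the enumeration starts with a basis of \<open>K\<close>, conditions on
  \<open>K\<close> become conditions on an initial segment of row indices.\<close>

lemma adapted_basis:
  assumes K: "cfun.subspace K" "K \<subseteq> cvecs d"
  obtains u where "inj_on u {..<d}" "cfun.independent (u ` {..<d})" "u ` {..<d} \<subseteq> cvecs d" "cvecs d \<subseteq> cfun.span (u ` {..<d})"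
    "cfun.dim K \<le> d" "u ` {..<cfun.dim K} \<subseteq> K" "K \<subseteq> cfun.span (u ` {..<cfun.dim K})"
proof -
  let ?F = "cunit ` {..<d}" and ?m = "cfun.dim K"
  have F: "cvecs d \<subseteq> cfun.span ?F" "K \<subseteq> cfun.span ?F" "finite ?F"
    by (rule cvecs_subset_span_cunit order_trans[OF K(2) cvecs_subset_span_cunit] finite_imageI[OF finite_lessThan])+
  obtain B0 where B0: "B0 \<subseteq> K" "cfun.independent B0" "K \<subseteq> cfun.span B0" "finite B0" "card B0 = ?m"
    by (rule cfun.basis_extend_finite[OF empty_subsetI cfun.independent_empty F(2,3)])
  have "B0 \<subseteq> cvecs d" using B0(1) K(2) by blast
  then obtain B where B: "B0 \<subseteq> B" "B \<subseteq> cvecs d" "cfun.independent B" "cvecs d \<subseteq> cfun.span B" "finite B"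
      "card B = cfun.dim (cvecs d)"
    by (rule cfun.basis_extend_finite[OF _ B0(2) F(1,3)])
  have cB: "card B = d" using B(6) dim_cvecs by simp
  have m: "?m \<le> d" using card_mono[OF B(5,1)] B0(5) cB by simp
  obtain g where g: "bij_betw g {0..<?m} B0" using ex_bij_betw_nat_finite[OF B0(4)] B0(5) by auto
  have "card (B - B0) = d - ?m" using B(1) B0(4,5) cB by (simp add: card_Diff_subset)
  then obtain h where h: "bij_betw h {0..<d - ?m} (B - B0)"
    using ex_bij_betw_nat_finite[of "B - B0"] B(5) by auto
  define u where "u = (\<lambda>i. if i < ?m then g i else h (i - ?m))"
  have "bij_betw (\<lambda>i. i - ?m) {?m..<d} {0..<d - ?m}"
    by (rule bij_betw_byWitness[where f' = "\<lambda>i. i + ?m"]) auto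
  from bij_betw_trans[OF this h] have "bij_betw u {?m..<d} (B - B0)"
    by (rule bij_betw_cong[THEN iffD1, rotated]) (simp add: u_def)
  moreover have u0: "bij_betw u {..<?m} B0"
    using g by (subst bij_betw_cong[of _ _ g]) (auto simp: u_def atLeast0LessThan)
  ultimately have "bij_betw u ({..<?m} \<union> {?m..<d}) (B0 \<union> (B - B0))"
    by (intro bij_betw_combine) auto
  moreover have "{..<?m} \<union> {?m..<d} = {..<d}" "B0 \<union> (B - B0) = B" using m B(1) by auto
  ultimately have "bij_betw u {..<d} B" by simp
  then have im: "inj_on u {..<d}" "u ` {..<d} = B" "u ` {..<?m} = B0"
    using u0 by (simp_all add: bij_betw_def)
  show thesis
  proof (rule that)
    show "inj_on u {..<d}" "cfun.independent (u ` {..<d})" "u ` {..<d} \<subseteq> cvecs d"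
      "cvecs d \<subseteq> cfun.span (u ` {..<d})"
      unfolding im(2) by (fact im(1) B(3) B(2) B(4))+
    show "?m \<le> d" by (fact m)
    show "u ` {..<?m} \<subseteq> K" "K \<subseteq> cfun.span (u ` {..<?m})"
      unfolding im(3) by (fact B0(1) B0(3))+
  qed
qed

section \<open>Definite determinantal representations\<close>

text \<open>The sesquilinear form u^* N w of the leading d by d block, conjugate-linear in
  \<open>u\<close>. With matrices as functions, pencils N + t M are formed pointwise.\<close>

definition mform :: "nat \<Rightarrow> (nat \<Rightarrow> nat \<Rightarrow> complex) \<Rightarrow> (nat \<Rightarrow> complex) \<Rightarrow> (nat \<Rightarrow> complex) \<Rightarrow> complex" where
  "mform d N u w = (\<Sum>r<d. \<Sum>c<d. cnj (u r) * N r c * w c)"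

definition mker :: "nat \<Rightarrow> (nat \<Rightarrow> nat \<Rightarrow> complex) \<Rightarrow> (nat \<Rightarrow> complex) set" where
  "mker d N = {y \<in> cvecs d. \<forall>r<d. (\<Sum>c<d. N r c * y c) = 0}"

lemma mform_sum_right: "mform d N u (\<Sum>j\<in>J. cscale (v j) (w j)) = (\<Sum>j\<in>J. v j * mform d N u (w j))"
proof -
  have "mform d N u (\<Sum>j\<in>J. cscale (v j) (w j)) = (\<Sum>r<d. \<Sum>c<d. \<Sum>j\<in>J. v j * (cnj (u r) * N r c * w j c))"
    by (simp add: mform_def sum_fun_apply cscale_def sum_distrib_left mult_ac)
  also have "\<dots> = (\<Sum>r<d. \<Sum>j\<in>J. \<Sum>c<d. v j * (cnj (u r) * N r c * w j c))"
    by (intro sum.cong refl sum.swap)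
  also have "\<dots> = (\<Sum>j\<in>J. \<Sum>r<d. \<Sum>c<d. v j * (cnj (u r) * N r c * w j c))"
    by (rule sum.swap)
  finally show ?thesis by (simp add: mform_def sum_distrib_left)
qed

lemma mform_add: "mform d (\<lambda>r c. N r c + M r c) u w = mform d N u w + mform d M u w"
  by (simp add: mform_def algebra_simps sum.distrib)

lemma mform_scale: "mform d (\<lambda>r c. t * M r c) u w = t * mform d M u w"
  by (simp add: mform_def sum_distrib_left mult_ac)

lemma subspace_mform_left: "cfun.subspace {x. mform d N x w = 0}"
proof -
  have "mform d N (x + y) w = mform d N x w + mform d N y w" for x y
    by (simp add: mform_def algebra_simps sum.distrib)
  moreover have "mform d N (cscale c x) w = cnj c * mform d N x w" for c x
    by (simp add: mform_def cscale_def sum_distrib_left mult_ac)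
  moreover have "mform d N 0 w = 0" by (simp add: mform_def)
  ultimately show ?thesis by (simp add: cfun.subspace_def)
qed

lemma mform_span_left:
  assumes "\<And>x. x \<in> S \<Longrightarrow> mform d N x w = 0" "x \<in> cfun.span S"
  shows "mform d N x w = 0"
proof -
  have "S \<subseteq> {x. mform d N x w = 0}" using assms(1) by auto
  from subsetD[OF cfun.span_minimal[OF this subspace_mform_left] assms(2)] show ?thesis by simp
qed

lemma mform_mker_right: "w \<in> mker d N \<Longrightarrow> mform d N u w = 0"
  by (simp add: mform_def mker_def mult.assoc sum_distrib_left[symmetric])

lemma mform_mker_left:
  assumes "\<And>r c. r < d \<Longrightarrow> c < d \<Longrightarrow> N c r = cnj (N r c)" "u \<in> mker d N"
  shows "mform d N u w = 0"
proof -
  have "mform d N u w = (\<Sum>c<d. \<Sum>r<d. cnj (u r) * N r c * w c)"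
    unfolding mform_def by (rule sum.swap)
  also have "\<dots> = (\<Sum>c<d. cnj (\<Sum>r<d. N c r * u r) * w c)"
  proof (intro sum.cong refl)
    fix c assume c: "c \<in> {..<d}"
    have "cnj (u r) * N r c * w c = cnj (N c r * u r) * w c" if "r \<in> {..<d}" for r
      using assms(1)[of c r] c that by simp
    then show "(\<Sum>r<d. cnj (u r) * N r c * w c) = cnj (\<Sum>r<d. N c r * u r) * w c"
      unfolding cnj_sum sum_distrib_right by (intro sum.cong refl)
  qed
  also have "\<dots> = 0" using assms(2) by (simp add: mker_def del: cnj_sum)
  finally show ?thesis .
qed

text \<open>Testing against unit vectors reads off the coordinates of N w.\<close>

lemma mker_of_mform_zero:
  assumes "\<And>x. x \<in> cvecs d \<Longrightarrow> mform d N x w = 0" "w \<in> cvecs d"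
  shows "w \<in> mker d N"
proof -
  have "(\<Sum>c<d. N r c * w c) = 0" if "r < d" for r
  proof -
    have "mform d N (cunit r) w = (\<Sum>r'<d. if r' = r then (\<Sum>c<d. N r c * w c) else 0)"
      unfolding mform_def cunit_def by (intro sum.cong refl) (auto simp: sum_distrib_left)
    also have "\<dots> = (\<Sum>c<d. N r c * w c)" using that by (simp add: sum.delta)
    finally show ?thesis using assms(1)[of "cunit r"] that by (simp add: cvecs_def cunit_def)
  qed
  then show ?thesis using assms(2) by (simp add: mker_def)
qed

lemma subspace_mker: "cfun.subspace (mker d N)"
proof -
  have "(\<Sum>c<d. N r c * (x + y) c) = (\<Sum>c<d. N r c * x c) + (\<Sum>c<d. N r c * y c)" for r x y
    by (simp add: distrib_left sum.distrib)
  moreover have "(\<Sum>c<d. N r c * cscale a x c) = a * (\<Sum>c<d. N r c * x c)" for r a x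
    by (simp add: cscale_def sum_distrib_left mult_ac)
  ultimately show ?thesis
    using subspace_cvecs[of d] unfolding cfun.subspace_def mker_def by simp
qed

section \<open>Determinants and the order of vanishing of a pencil\<close>

lemma det_mat_row_factor:
  "det (mat d d (\<lambda>(i,j). a i * f i j)) = (\<Prod>i<d. a i) * det (mat d d (\<lambda>(i,j). f i j))"
  for a :: "nat \<Rightarrow> complex"
proof -
  have "(\<Prod>i = 0..<d. mat d d (\<lambda>(i,j). a i * f i j) $$ (i, p i)) =
      (\<Prod>i<d. a i) * (\<Prod>i = 0..<d. mat d d (\<lambda>(i,j). f i j) $$ (i, p i))" if "p permutes {0..<d}" for p
  proof -
    have "p i < d" if "i < d" for i using permutes_in_image[OF \<open>p permutes {0..<d}\<close>, of i] that by simp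
    then show ?thesis by (simp add: prod.distrib atLeast0LessThan)
  qed
  then show ?thesis by (simp add: det_def sum_distrib_left mult_ac)
qed

lemma tendsto_det:
  fixes f :: "'b \<Rightarrow> nat \<Rightarrow> nat \<Rightarrow> complex"
  assumes "\<And>i j. i < d \<Longrightarrow> j < d \<Longrightarrow> ((\<lambda>t. f t i j) \<longlongrightarrow> g i j) F"
  shows "((\<lambda>t. det (mat d d (\<lambda>(i,j). f t i j))) \<longlongrightarrow> det (mat d d (\<lambda>(i,j). g i j))) F"
proof -
  have "((\<lambda>t. mat d d (\<lambda>(i,j). f t i j) $$ (i, p i)) \<longlongrightarrow> mat d d (\<lambda>(i,j). g i j) $$ (i, p i)) F"
    if "p permutes {0..<d}" "i \<in> {0..<d}" for p i
    using that permutes_in_image[OF that(1), of i] assms by simp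
  then show ?thesis by (auto simp: det_def intro!: tendsto_intros)
qed

text \<open>The matrix of the form in the vectors u_i is a product L N R with L and R built from
  \<open>u\<close> alone, so a single factor \<open>c\<close> serves every N and stays constant
  along a pencil.\<close>

lemma det_congruence:
  fixes N :: "nat \<Rightarrow> nat \<Rightarrow> complex" and u :: "nat \<Rightarrow> nat \<Rightarrow> complex"
  obtains c where "\<And>N. det (mat d d (\<lambda>(i,j). mform d N (u i) (u j))) = c * det (mat d d (\<lambda>(i,j). N i j))"
proof
  fix N :: "nat \<Rightarrow> nat \<Rightarrow> complex"
  let ?L = "mat d d (\<lambda>(i,j). cnj (u i j))" and ?R = "mat d d (\<lambda>(i,j). u j i)" and ?N = "mat d d (\<lambda>(i,j). N i j)"
  have "mat d d (\<lambda>(i,j). mform d N (u i) (u j)) = ?L * (?N * ?R)"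
    by (rule eq_matI) (auto simp: scalar_prod_def mform_def sum_distrib_left mult_ac atLeast0LessThan)
  then have "det (mat d d (\<lambda>(i,j). mform d N (u i) (u j))) = det ?L * (det ?N * det ?R)"
    by (simp only: det_mult[OF mat_carrier mult_carrier_mat[OF mat_carrier mat_carrier]]
        det_mult[OF mat_carrier mat_carrier])
  then show "det (mat d d (\<lambda>(i,j). mform d N (u i) (u j))) = (det ?L * det ?R) * det ?N"
    by (simp add: mult_ac)
qed

lemma det_zero_imp_kernel:
  fixes f :: "nat \<Rightarrow> nat \<Rightarrow> complex"
  assumes "det (mat d d (\<lambda>(i,j). f i j)) = 0"
  obtains v i where "i < d" "v i \<noteq> 0" "\<And>i. i < d \<Longrightarrow> (\<Sum>j<d. f i j * v j) = 0"
proof -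
  obtain x where x: "x \<in> carrier_vec d" "x \<noteq> 0\<^sub>v d" "mat d d (\<lambda>(i,j). f i j) *\<^sub>v x = 0\<^sub>v d"
    using assms det_0_iff_vec_prod_zero_field[of "mat d d (\<lambda>(i,j). f i j)" d] by auto
  obtain i where "i < d" "x $ i \<noteq> 0" using x(1,2) by (auto simp: vec_eq_iff)
  moreover have "(\<Sum>j<d. f i j * x $ j) = 0" if "i < d" for i
    using arg_cong[OF x(3), of "\<lambda>v. v $ i"] that x(1) by (simp add: scalar_prod_def atLeast0LessThan)
  ultimately show thesis using that[of i "\<lambda>i. x $ i"] by blast
qed

lemma mker_zero_if_det_nonzero:
  fixes N :: "nat \<Rightarrow> nat \<Rightarrow> complex"
  assumes "det (mat d d (\<lambda>(i,j). N i j)) \<noteq> 0"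
  shows "mker d N = {0}"
proof -
  have "y = 0" if "y \<in> mker d N" for y
  proof (rule ccontr)
    assume "y \<noteq> 0"
    then obtain i where i: "y i \<noteq> 0" by (auto simp: fun_eq_iff)
    then have "i < d" using that by (auto simp: mker_def cvecs_def not_le[symmetric])
    then have "vec d y \<noteq> 0\<^sub>v d" using i by (auto simp: vec_eq_iff)
    moreover have "mat d d (\<lambda>(i,j). N i j) *\<^sub>v vec d y = 0\<^sub>v d"
      using that by (auto simp: vec_eq_iff scalar_prod_def atLeast0LessThan mker_def)
    ultimately show False
      using assms det_0_iff_vec_prod_zero_field[of "mat d d (\<lambda>(i,j). N i j)" d, OF mat_carrier]
        vec_carrier[of d y] by blast
  qed
  moreover have "0 \<in> mker d N" using subspace_mker cfun.subspace_0 by blast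
  ultimately show ?thesis by auto
qed

text \<open>In a basis whose first m vectors span the kernel of N, the first m rows of N + t M are
  divisible by t, and what remains after dividing them by t is invertible at t = 0.\<close>

lemma order_of_vanishing_le_nullity:
  fixes N M :: "nat \<Rightarrow> nat \<Rightarrow> complex" and h :: "real \<Rightarrow> complex"
  assumes herm: "\<And>r c. r < d \<Longrightarrow> c < d \<Longrightarrow> N c r = cnj (N r c)"
    and M: "\<And>y. y \<in> cvecs d \<Longrightarrow> mform d M y y = 0 \<Longrightarrow> y = 0"
    and det: "\<And>t. t > 0 \<Longrightarrow> det (mat d d (\<lambda>(i,j). N i j + of_real t * M i j)) = of_real t ^ n * h t"
    and h: "(h \<longlongrightarrow> h0) (at_right 0)"
  shows "n \<le> cfun.dim (mker d N)"
proof (rule ccontr)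
  let ?K = "mker d N" and ?m = "cfun.dim (mker d N)"
  assume "\<not> n \<le> ?m"
  then have mn: "?m < n" by simp
  have "?K \<subseteq> cvecs d" by (auto simp: mker_def)
  then obtain u where u: "inj_on u {..<d}" "cfun.independent (u ` {..<d})" "u ` {..<d} \<subseteq> cvecs d"
    "cvecs d \<subseteq> cfun.span (u ` {..<d})" "?m \<le> d" "u ` {..<?m} \<subseteq> ?K" "?K \<subseteq> cfun.span (u ` {..<?m})"
    by (rule adapted_basis[OF subspace_mker])
  obtain c where c: "\<And>N. det (mat d d (\<lambda>(i,j). mform d N (u i) (u j))) = c * det (mat d d (\<lambda>(i,j). N i j))"
    using det_congruence[of d u] by blast
  define L where "L = (\<lambda>(t::real) i j. if i < ?m then mform d M (u i) (u j)
     else mform d N (u i) (u j) + of_real t * mform d M (u i) (u j))"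
  have u_ker: "u i \<in> ?K" if "i < ?m" for i using u(6) that by auto
  have factor: "mform d (\<lambda>r c. N r c + of_real t * M r c) (u i) (u j) =
     (if i < ?m then of_real t else 1) * L t i j" for t i j
    unfolding L_def mform_add mform_scale using mform_mker_left[OF herm u_ker] by simp
  have detL: "det (mat d d (\<lambda>(i,j). L t i j)) = c * of_real t ^ (n - ?m) * h t" if t: "t > 0" for t
  proof -
    have "(\<Prod>i<d. if i < ?m then of_real t else 1) = (of_real t ^ ?m :: complex)"
    proof -
      have "(\<Prod>i<d. if i < ?m then of_real t else 1) = (\<Prod>i\<in>{i\<in>{..<d}. i < ?m}. of_real t :: complex)"
        by (rule prod.inter_filter[symmetric]) simp
      also have "{i\<in>{..<d}. i < ?m} = {..<?m}" using u(5) by auto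
      finally show ?thesis by simp
    qed
    then have "of_real t ^ ?m * det (mat d d (\<lambda>(i,j). L t i j)) =
        det (mat d d (\<lambda>(i,j). mform d (\<lambda>r c. N r c + of_real t * M r c) (u i) (u j)))"
      unfolding factor det_mat_row_factor by simp
    also have "\<dots> = c * (of_real t ^ n * h t)" unfolding c det[OF t] ..
    also have "(of_real t ^ n :: complex) = of_real t ^ ?m * of_real t ^ (n - ?m)"
      using mn by (simp flip: power_add)
    finally have "of_real t ^ ?m * det (mat d d (\<lambda>(i,j). L t i j)) = of_real t ^ ?m * (c * of_real t ^ (n - ?m) * h t)"
      by (simp add: mult_ac)
    then show ?thesis using t by simp
  qed
  have "((\<lambda>t. det (mat d d (\<lambda>(i,j). L t i j))) \<longlongrightarrow> det (mat d d (\<lambda>(i,j). L 0 i j))) (at_right 0)"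
  proof (rule tendsto_det)
    have "((\<lambda>t::real. complex_of_real t) \<longlongrightarrow> of_real 0) (at_right 0)" by (intro tendsto_intros)
    then show "((\<lambda>t. L t i j) \<longlongrightarrow> L 0 i j) (at_right 0)" for i j
      unfolding L_def by (auto intro!: tendsto_eq_intros)
  qed
  \<comment> \<open>As n exceeds the nullity, a positive power of t remains in det L, so
    \<open>L 0\<close> is singular.\<close>
  moreover have "((\<lambda>t. det (mat d d (\<lambda>(i,j). L t i j))) \<longlongrightarrow> 0) (at_right 0)"
  proof -
    have "((\<lambda>t. c * of_real t ^ (n - ?m) * h t) \<longlongrightarrow> c * of_real 0 ^ (n - ?m) * h0) (at_right 0)"
      by (intro tendsto_intros h)
    moreover have "eventually (\<lambda>t. c * of_real t ^ (n - ?m) * h t = det (mat d d (\<lambda>(i,j). L t i j))) (at_right 0)"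
      using eventually_at_right_less[of "0::real"] by eventually_elim (simp add: detL)
    ultimately show ?thesis using mn by (simp add: Lim_transform_eventually zero_power)
  qed
  ultimately have "det (mat d d (\<lambda>(i,j). L 0 i j)) = 0"
    using tendsto_unique trivial_limit_at_right_real by blast
  then obtain v i0 where v: "i0 < d" "v i0 \<noteq> 0" "\<And>i. i < d \<Longrightarrow> (\<Sum>j<d. L 0 i j * v j) = 0"
    by (rule det_zero_imp_kernel) blast
  \<comment> \<open>The first ?m rows make \<open>y\<close> orthogonal to the kernel with respect to
    M, and the other rows give N y = 0. So \<open>y\<close> lies in the kernel and M(y, y) = 0;
    definiteness yields y = 0, although v is nonzero.\<close>
  define y where "y = (\<Sum>j<d. cscale (v j) (u j))"
  have yc: "y \<in> cvecs d" unfolding y_def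
    using u(3) by (intro cfun.subspace_sum cfun.subspace_scale subspace_cvecs) auto
  have My: "mform d M (u i) y = 0" if "i < ?m" for i
    using v(3)[of i] that u(5) unfolding y_def mform_sum_right L_def by (simp add: mult.commute)
  have Ny: "mform d N (u i) y = 0" if "i < d" for i
  proof (cases "i < ?m")
    case True
    then show ?thesis using mform_mker_left[OF herm u_ker] by simp
  next
    case False
    then show ?thesis using v(3)[OF that] unfolding y_def mform_sum_right L_def by (simp add: mult.commute)
  qed
  have "y \<in> ?K"
  proof (rule mker_of_mform_zero[OF _ yc])
    fix x assume "x \<in> cvecs d"
    then show "mform d N x y = 0" using mform_span_left[of "u ` {..<d}" d N y x] Ny u(4) by auto
  qed
  then have "mform d M y y = 0" using mform_span_left[of "u ` {..<?m}" d M y y] My u(7) by auto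
  then have "y = 0" by (rule M[OF yc])
  moreover have "y = (\<Sum>x\<in>u ` {..<d}. cscale (v (the_inv_into {..<d} u x)) x)"
    unfolding y_def using u(1) by (subst sum.reindex) (auto simp: the_inv_into_f_f)
  ultimately have "v (the_inv_into {..<d} u (u i0)) = 0"
    using v(1) u(2) by (intro cfun.independentD[OF u(2), of "u ` {..<d}"]) auto
  then show False using v(1,2) u(1) by (simp add: the_inv_into_f_f)
qed

lemma Re_mform_expand:
  assumes herm: "\<And>r c. r < d \<Longrightarrow> c < d \<Longrightarrow> N c r = cnj (N r c)"
  shows "Re (mform d N (\<lambda>i. y i - of_real s * w i) (\<lambda>i. y i - of_real s * w i))
    = Re (mform d N y y) - 2 * s * Re (mform d N w y) + s^2 * Re (mform d N w w)"
proof -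
  have "mform d N y w = cnj (mform d N w y)"
  proof -
    have "cnj (mform d N w y) = (\<Sum>r<d. \<Sum>c<d. w r * cnj (N r c) * cnj (y c))"
      by (simp add: mform_def)
    also have "\<dots> = (\<Sum>r<d. \<Sum>c<d. cnj (y c) * N c r * w r)"
    proof (intro sum.cong refl)
      fix r c assume "r \<in> {..<d}" "c \<in> {..<d}"
      then have "cnj (N r c) = N c r" by (intro herm[symmetric]) auto
      then show "w r * cnj (N r c) * cnj (y c) = cnj (y c) * N c r * w r" by (simp add: mult_ac)
    qed
    also have "\<dots> = mform d N y w" unfolding mform_def by (rule sum.swap)
    finally show ?thesis by simp
  qed
  moreover have "mform d N (\<lambda>i. y i - of_real s * w i) (\<lambda>i. y i - of_real s * w i)
    = mform d N y y - of_real s * (mform d N w y + mform d N y w) + of_real (s^2) * mform d N w w"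
  proof -
    have "mform d N (\<lambda>i. y i - of_real s * w i) (\<lambda>i. y i - of_real s * w i) =
      (\<Sum>r<d. \<Sum>c<d. cnj (y r) * N r c * y c - of_real s * (cnj (w r) * N r c * y c + cnj (y r) * N r c * w c)
        + of_real (s^2) * (cnj (w r) * N r c * w c))"
      unfolding mform_def by (intro sum.cong refl) (simp add: algebra_simps power2_eq_square)
    then show ?thesis
      by (simp add: mform_def sum.distrib sum_subtractf flip: sum_distrib_left)
  qed
  ultimately show ?thesis by simp
qed

text \<open>With w = N y the real part of the form at y - s w is -2 s |N y|^2 + s^2 F. Its
  nonnegativity for small s > 0 forces N y = 0.\<close>

lemma psd_mform_zero_imp_mker:
  assumes herm: "\<And>r c. r < d \<Longrightarrow> c < d \<Longrightarrow> N c r = cnj (N r c)"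
    and psd: "\<And>u. Re (mform d N u u) \<ge> 0"
    and y: "y \<in> cvecs d" "Re (mform d N y y) = 0"
  shows "y \<in> mker d N"
proof -
  define w where "w = (\<lambda>r. \<Sum>c<d. N r c * y c)"
  define S F where "S = Re (mform d N w y)" and "F = Re (mform d N w w)"
  have "mform d N w y = (\<Sum>r<d. cnj (w r) * w r)"
    by (simp add: mform_def w_def sum_distrib_left mult.assoc)
  then have S: "S = (\<Sum>r<d. (cmod (w r))^2)"
    by (simp only: S_def Re_sum cmod_power2) (simp add: power2_eq_square)
  have quad: "0 \<le> - 2 * s * S + s^2 * F" for s
    using psd[of "\<lambda>i. y i - of_real s * w i"] Re_mform_expand[OF herm] y(2)
    by (simp add: S_def F_def)
  have *: "2 * s * S \<le> s^2 * F" for s using quad[of s] by simp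
  have "S \<le> 0"
  proof (rule ccontr)
    assume "\<not> S \<le> 0"
    then have "S > 0" by simp
    have "F \<ge> 0" unfolding F_def by (rule psd)
    \<comment> \<open>The 1 in the denominator covers F = 0 and still gives s F \<le> S, against 2 S
      \<le> s F.\<close>
    define s where "s = S / (F + 1)"
    have "s > 0" using \<open>S > 0\<close> \<open>F \<ge> 0\<close> by (simp add: s_def)
    then have "2 * S \<le> s * F" using *[of s] by (simp add: power2_eq_square)
    also have "\<dots> \<le> S" using \<open>S > 0\<close> \<open>F \<ge> 0\<close> by (simp add: s_def field_simps)
    finally show False using \<open>S > 0\<close> by simp
  qed
  then have "(\<Sum>r<d. (cmod (w r))^2) = 0" using S sum_nonneg[of "{..<d}" "\<lambda>r. (cmod (w r))^2"] by simp
  then have "\<forall>r<d. w r = 0" by (simp add: sum_nonneg_eq_0_iff)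
  then show ?thesis using y(1) by (simp add: mker_def w_def)
qed

section \<open>Generating polynomials at and near indicator vectors\<close>

text \<open>Only monomials of bases contained in S survive, and by cardinality S is the only such
  basis.\<close>

lemma basis_gen_poly_indicator:
  assumes "finite \<B>" "\<And>B. B \<in> \<B> \<Longrightarrow> finite B \<and> card B = n" "S \<in> \<B>"
  shows "basis_gen_poly \<B> (\<lambda>i. if i \<in> S then 1 else 0) = (1::'a::{comm_ring_1,semiring_no_zero_divisors})"
proof -
  have "(\<Prod>i\<in>B. if i \<in> S then 1 else 0) = (if B = S then 1 else (0::'a))" if "B \<in> \<B>" for B
  proof (cases "B = S")
    case False
    have "\<not> B \<subseteq> S" using False card_subset_eq[of S B] assms(2)[OF that] assms(2)[OF assms(3)] by auto
    then obtain i where "i \<in> B" "i \<notin> S" by blast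
    then show ?thesis using False assms(2)[OF that] by (auto intro!: prod_zero)
  qed auto
  then have "basis_gen_poly \<B> (\<lambda>i. if i \<in> S then 1 else 0) = (\<Sum>B\<in>\<B>. if B = S then 1 else (0::'a))"
    unfolding basis_gen_poly_def by (intro sum.cong refl)
  then show ?thesis using assms(1,3) by simp
qed

text \<open>The monomial of B is t^|B - S| (1 + t)^|B \<inter> S| with |B - S| \<ge> n - r. The
  extracted power of t bounds the order of vanishing from below.\<close>

lemma basis_gen_poly_perturbed_indicator:
  fixes t :: "'a::comm_ring_1"
  assumes "\<And>B. B \<in> \<B> \<Longrightarrow> finite B \<and> card B = n \<and> card (B \<inter> S) \<le> r" "r \<le> n"
  shows "basis_gen_poly \<B> (\<lambda>i. (if i \<in> S then 1 else 0) + t) =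
    t ^ (n - r) * (\<Sum>B\<in>\<B>. t ^ (r - card (B \<inter> S)) * (1 + t) ^ card (B \<inter> S))"
  unfolding basis_gen_poly_def sum_distrib_left
proof (intro sum.cong refl)
  fix B assume "B \<in> \<B>"
  note B = assms(1)[OF this]
  have "(\<Prod>i\<in>B. (if i \<in> S then 1 else 0) + t) = (\<Prod>i\<in>(B \<inter> S) \<union> (B - S). (if i \<in> S then 1 else 0) + t)"
    by (simp add: Int_Diff_Un)
  also have "\<dots> = (\<Prod>i\<in>B \<inter> S. (if i \<in> S then 1 else 0) + t) * (\<Prod>i\<in>B - S. (if i \<in> S then 1 else 0) + t)"
    using B by (intro prod.union_disjoint) auto
  also have "\<dots> = (\<Prod>i\<in>B \<inter> S. 1 + t) * (\<Prod>i\<in>B - S. t)"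
    by (intro arg_cong2[where f = "(*)"] prod.cong) auto
  also have "\<dots> = (1 + t) ^ card (B \<inter> S) * t ^ card (B - S)" by simp
  also have "card (B - S) = (n - r) + (r - card (B \<inter> S))"
    using B assms(2) by (simp add: card_Diff_subset_Int)
  finally show "(\<Prod>i\<in>B. (if i \<in> S then 1 else 0) + t) =
      t ^ (n - r) * (t ^ (r - card (B \<inter> S)) * (1 + t) ^ card (B \<inter> S))"
    by (simp add: power_add mult_ac)
qed

lemma V10_basesD: "B \<in> V10_bases \<Longrightarrow> finite B \<and> card B = 4 \<and> B \<subseteq> {1..10}"
  using finite_subset[of B "{1..10}"] by (simp add: V10_bases_iff)

lemma finite_V10_bases: "finite V10_bases"
  by (rule finite_subset[of _ "Pow {1..10}"]) (use V10_basesD in blast, simp)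

lemma V10_basesI:
  assumes "distinct [a,b,c,d]" "{a,b,c,d} \<subseteq> {1..10}" "{a,b,c,d} \<notin> V10_circuit_hyperplanes"
  shows "{a,b,c,d} \<in> V10_bases"
  using assms by (simp add: V10_bases_iff)

lemma card_Int_V10_circuit_hyperplane:
  assumes "S \<in> V10_circuit_hyperplanes" "B \<in> V10_bases"
  shows "card (B \<inter> S) \<le> 3"
proof -
  have S: "finite S" "card S = 4"
    using assms(1) unfolding V10_circuit_hyperplanes_def insert_iff empty_iff by (elim disjE; simp)+
  have B: "finite B" "card B = 4" using V10_basesD[OF assms(2)] by auto
  have "B \<noteq> S" using assms V10_bases_iff by blast
  then have "B \<inter> S \<noteq> B" using B S card_subset_eq[of S B] by auto
  then have "card (B \<inter> S) < card B" using B by (intro psubset_card_mono) auto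
  then show ?thesis using B by simp
qed

section \<open>The dimension count against a Vamos configuration\<close>

definition sum_space :: "(nat \<Rightarrow> complex) set \<Rightarrow> (nat \<Rightarrow> complex) set \<Rightarrow> (nat \<Rightarrow> complex) set" where
  "sum_space U V = {x + y |x y. x \<in> U \<and> y \<in> V}"

definition csubspace_of :: "nat \<Rightarrow> (nat \<Rightarrow> complex) set \<Rightarrow> bool" where
  "csubspace_of d U \<longleftrightarrow> cfun.subspace U \<and> U \<subseteq> cvecs d"

lemma csubspace_of_sum_space:
  assumes "csubspace_of d U" "csubspace_of d V"
  shows "csubspace_of d (sum_space U V)"
proof -
  have "x + y \<in> cvecs d" if "x \<in> cvecs d" "y \<in> cvecs d" for x y
    using that by (simp add: cvecs_def)
  then have "sum_space U V \<subseteq> cvecs d" using assms by (auto simp: csubspace_of_def sum_space_def)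
  then show ?thesis
    using cfun.subspace_sums[of U V] assms by (simp add: csubspace_of_def sum_space_def)
qed

lemma dim_sum_space_Int:
  "csubspace_of d U \<Longrightarrow> csubspace_of d V \<Longrightarrow>
    cfun.dim (sum_space U V) + cfun.dim (U \<inter> V) = cfun.dim U + cfun.dim V"
  unfolding csubspace_of_def sum_space_def by (rule dim_Int_sum_cvecs[where d = d]) simp_all

lemma dim_le_csubspace_of: "csubspace_of d U \<Longrightarrow> cfun.dim U \<le> d"
  using dim_mono_cvecs[of U "cvecs d" d] by (simp add: csubspace_of_def dim_cvecs)

lemma dim_zero_space: "cfun.dim {0} = 0"
  using cfun.dim_le_card[of "{0}" "{}"] by simp

lemma zero_in_csubspace_of: "csubspace_of d U \<Longrightarrow> 0 \<in> U"
  by (simp add: csubspace_of_def cfun.subspace_0)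

lemma dim_sum_space_direct:
  assumes "csubspace_of d U" "csubspace_of d V" "U \<inter> V \<subseteq> {0}"
  shows "cfun.dim (sum_space U V) = cfun.dim U + cfun.dim V"
proof -
  have "U \<inter> V = {0}" using assms zero_in_csubspace_of by blast
  then show ?thesis using dim_sum_space_Int[OF assms(1,2)] dim_zero_space by simp
qed

text \<open>\<open>P\<close> and \<open>Q\<close> are subspaces of \<open>W\<close> of dimension at
  least 2k with trivial intersection, so dim W \<ge> 4k. On the other hand dim W \<le> 2k + 2k - k,
  since the two summands of \<open>W\<close> meet in dimension at least k.\<close>

lemma kernel_arrangement_not_Vamos:
  fixes K :: "nat set \<Rightarrow> (nat \<Rightarrow> complex) set"
  assumes k: "k > 0" and d: "d = 4 * k"
    and sub: "\<And>S. csubspace_of d (K S)" and Un: "\<And>S T. K (S \<union> T) = K S \<inter> K T"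
    and single: "3 * k \<le> cfun.dim (K {3})" "3 * k \<le> cfun.dim (K {5})" "3 * k \<le> cfun.dim (K {1})"
    and hyper: "k \<le> cfun.dim (K {1,2,3,4})" "k \<le> cfun.dim (K {1,2,5,6})" "k \<le> cfun.dim (K {1,2,7,8})"
       "k \<le> cfun.dim (K {3,4,5,6})" "k \<le> cfun.dim (K {5,6,7,8})"
    and basis: "K {1,2,3,5} = {0}" "K {1,3,5,6} = {0}" "K {1,2,5,7} = {0}" "K {3,4,7,8} = {0}"
  shows False
proof -
  have mono: "K T \<subseteq> K S" if "S \<subseteq> T" for S T
    using Un[of S T] that by (auto simp: sup_absorb2)
  \<comment> \<open>In dimension 4k, two subspaces of dimension at least 3k meet in dimension at
    least 2k.\<close>
  have pair: "2 * k \<le> cfun.dim (K {i,j})" if "3 * k \<le> cfun.dim (K {i})" "3 * k \<le> cfun.dim (K {j})" for i j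
  proof -
    have "{i,j} = {i} \<union> {j}" by auto
    then have "K {i,j} = K {i} \<inter> K {j}" by (simp only: Un)
    then show ?thesis
      using dim_sum_space_Int[OF sub sub, of "{i}" "{j}"]
        dim_le_csubspace_of[OF csubspace_of_sum_space[OF sub sub], of "{i}" "{j}"] that d by simp
  qed
  have upper: "cfun.dim (K S) \<le> 2 * k" if "2 * k \<le> cfun.dim (K T)" "K (S \<union> T) = {0}" for S T
    using dim_sum_space_direct[OF sub sub, of S T] Un[of S T] that d
      dim_le_csubspace_of[OF csubspace_of_sum_space[OF sub sub], of S T] by simp
  \<comment> \<open>{3,5} and {1,3} complete {1,2} and {5,6} to bases, so their kernels, of
    dimension at least 2k, leave at most 2k for the kernels of {1,2} and {5,6}.\<close>
  have "{1,2} \<union> {3,5} = {1,2,3,5::nat}" "{5,6} \<union> {1,3} = {1,3,5,6::nat}" by auto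
  then have A: "cfun.dim (K {1,2}) \<le> 2 * k" and B: "cfun.dim (K {5,6}) \<le> 2 * k"
    using upper[OF pair[OF single(1,2)], of "{1,2}"] upper[OF pair[OF single(3,1)], of "{5,6}"] basis by simp_all
  define W where "W = sum_space (K {1,2}) (K {5,6})"
  have subW: "csubspace_of d W" unfolding W_def by (intro csubspace_of_sum_space sub)
  have "{1,2} \<union> {5,6} = {1,2,5,6::nat}" by auto
  then have "K {1,2} \<inter> K {5,6} = K {1,2,5,6}" by (simp only: Un[symmetric])
  then have W: "cfun.dim W \<le> 3 * k"
    using dim_sum_space_Int[OF sub sub, of "{1,2}" "{5,6}"] A B hyper(2) unfolding W_def by simp
  define P where "P = sum_space (K {1,2,3,4}) (K {3,4,5,6})"
  define Q where "Q = sum_space (K {1,2,7,8}) (K {5,6,7,8})"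
  have subP: "csubspace_of d P" and subQ: "csubspace_of d Q"
    unfolding P_def Q_def by (intro csubspace_of_sum_space sub)+
  have closed: "x + y \<in> K S" if "x \<in> K S" "y \<in> K S" for x y S
    using that sub[of S] cfun.subspace_add by (auto simp: csubspace_of_def)
  have Wclosed: "x + y \<in> W" if "x \<in> W" "y \<in> W" for x y
    using that subW cfun.subspace_add by (auto simp: csubspace_of_def)
  \<comment> \<open>The union of the two index sets contains the basis {1,2,3,5}, so the sum
    defining \<open>P\<close> is direct. For \<open>Q\<close> the basis {1,2,5,7} plays this
    role.\<close>
  have "K {1,2,3,4} \<inter> K {3,4,5,6} \<subseteq> {0}"
    unfolding Un[symmetric] basis(1)[symmetric] by (rule mono) auto
  then have dP: "2 * k \<le> cfun.dim P"
    unfolding P_def using dim_sum_space_direct[OF sub sub] hyper(1,4) by simp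
  have "K {1,2,7,8} \<inter> K {5,6,7,8} \<subseteq> {0}"
    unfolding Un[symmetric] basis(3)[symmetric] by (rule mono) auto
  then have dQ: "2 * k \<le> cfun.dim Q"
    unfolding Q_def using dim_sum_space_direct[OF sub sub] hyper(3,5) by simp
  have "K {1,2,3,4} \<subseteq> K {3,4}" "K {3,4,5,6} \<subseteq> K {3,4}" "K {1,2,7,8} \<subseteq> K {7,8}" "K {5,6,7,8} \<subseteq> K {7,8}"
    by (intro mono; simp)+
  then have "P \<subseteq> K {3,4}" "Q \<subseteq> K {7,8}" unfolding P_def Q_def sum_space_def using closed by blast+
  moreover have "{3,4} \<union> {7,8} = {3,4,7,8::nat}" by auto
  then have "K {3,4} \<inter> K {7,8} = {0}" by (simp only: Un[symmetric] basis(4))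
  ultimately have "P \<inter> Q \<subseteq> {0}" by blast
  then have "4 * k \<le> cfun.dim (sum_space P Q)"
    using dim_sum_space_direct[OF subP subQ] dP dQ by simp
  moreover have "K {1,2,3,4} \<subseteq> K {1,2}" "K {3,4,5,6} \<subseteq> K {5,6}" "K {1,2,7,8} \<subseteq> K {1,2}" "K {5,6,7,8} \<subseteq> K {5,6}"
    by (intro mono; simp)+
  then have "P \<subseteq> W" "Q \<subseteq> W" unfolding P_def Q_def W_def sum_space_def by blast+
  then have "sum_space P Q \<subseteq> W" unfolding sum_space_def using Wclosed by blast
  then have "cfun.dim (sum_space P Q) \<le> cfun.dim W"
    using subW dim_mono_cvecs by (auto simp: csubspace_of_def)
  ultimately show False using W k by simp
qed

lemma no_definite_det_rep_V10:
  assumes "k > 0"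
  shows "\<not> has_definite_det_rep {1..10} (\<lambda>x. basis_gen_poly V10_bases x) k"
proof
  let ?E = "{1..10::nat}"
  let ?f = "\<lambda>x :: nat \<Rightarrow> real. basis_gen_poly V10_bases x"
  assume "has_definite_det_rep ?E ?f k"
  then obtain d and A :: "nat \<Rightarrow> complex mat" where psd: "\<And>i. i \<in> ?E \<Longrightarrow> psd_hermitian_mat d (A i)"
    and det: "\<And>x. complex_of_real (?f x ^ k) =
       det (mat d d (\<lambda>(r, c). \<Sum>i\<in>?E. complex_of_real (x i) * A i $$ (r, c)))"
    unfolding has_definite_det_rep_def by blast
  define a where "a = (\<lambda>i r c. A i $$ (r, c))"
  have herm: "a i c r = cnj (a i r c)" if "i \<in> ?E" "r < d" "c < d" for i r c
    using psd[OF that(1)] that(2,3) unfolding psd_hermitian_mat_def hermitian_mat_def a_def by blast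
  have nonneg: "Re (mform d (a i) u u) \<ge> 0" if "i \<in> ?E" for i u
    using psd[OF that] unfolding psd_hermitian_mat_def mform_def a_def by blast
  define N where "N = (\<lambda>S r c. \<Sum>i\<in>S. a i r c)"
  have mformN: "mform d (N S) u w = (\<Sum>i\<in>S. mform d (a i) u w)" if "finite S" for S u w
    using that
  proof (induction S)
    case empty
    then show ?case by (simp add: N_def mform_def)
  next
    case (insert i S)
    then have "N (insert i S) = (\<lambda>r c. a i r c + N S r c)" by (simp add: N_def)
    then show ?case using insert by (simp add: mform_add)
  qed
  define K where "K = (\<lambda>S. {y \<in> cvecs d. \<forall>i\<in>S. y \<in> mker d (a i)})"
  have subK: "csubspace_of d (K S)" for S
    using subspace_mker[of d] subspace_cvecs[of d]
    unfolding K_def csubspace_of_def cfun.subspace_def by blast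
  have UnK: "K (S \<union> T) = K S \<inter> K T" for S T unfolding K_def by blast
  have Kker: "K S \<subseteq> mker d (N S)" for S
  proof
    fix y assume y: "y \<in> K S"
    have "(\<Sum>c<d. N S r c * y c) = 0" if "r < d" for r
    proof -
      have "(\<Sum>c<d. N S r c * y c) = (\<Sum>i\<in>S. \<Sum>c<d. a i r c * y c)"
        unfolding N_def sum_distrib_right by (rule sum.swap)
      also have "\<dots> = 0" using y that by (intro sum.neutral) (auto simp: K_def mker_def)
      finally show ?thesis .
    qed
    then show "y \<in> mker d (N S)" using y by (simp add: K_def mker_def)
  qed
  \<comment> \<open>The values of the semidefinite forms \<open>a i\<close> at \<open>y\<close> are
    nonnegative and add up to zero, so each vanishes and \<open>y\<close> lies in each kernel. Hence
    the kernel of \<open>N S\<close> is the common kernel \<open>K S\<close>.\<close>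
  have K_of_mform: "y \<in> K S" if "S \<subseteq> ?E" "y \<in> cvecs d" "mform d (N S) y y = 0" for S y
  proof -
    have fin: "finite S" using that(1) finite_subset by blast
    have "(\<Sum>i\<in>S. Re (mform d (a i) y y)) = 0"
      using that(3) mformN[OF fin, of y y] by (simp flip: Re_sum)
    then have zero: "\<forall>i\<in>S. Re (mform d (a i) y y) = 0"
      using fin that(1) nonneg by (subst (asm) sum_nonneg_eq_0_iff) auto
    have "y \<in> mker d (a i)" if "i \<in> S" for i
    proof (rule psd_mform_zero_imp_mker)
      show "a i c r = cnj (a i r c)" if "r < d" "c < d" for r c
        by (rule herm[OF subsetD[OF \<open>S \<subseteq> ?E\<close> \<open>i \<in> S\<close>] that])
      show "Re (mform d (a i) u u) \<ge> 0" for u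
        by (rule nonneg[OF subsetD[OF \<open>S \<subseteq> ?E\<close> \<open>i \<in> S\<close>]])
      show "Re (mform d (a i) y y) = 0" using zero that by blast
    qed fact
    then show ?thesis using that(2) by (simp add: K_def)
  qed
  have ker_eq: "mker d (N S) = K S" if "S \<subseteq> ?E" for S
    using Kker[of S] K_of_mform[OF that] mform_mker_right by (auto simp: mker_def)
  \<comment> \<open>The representation is evaluated at the indicator vector of S plus t times the
    all-ones vector.\<close>
  have detN: "det (mat d d (\<lambda>(r,c). N S r c + of_real t * N ?E r c)) =
      of_real (?f (\<lambda>i. (if i \<in> S then 1 else 0) + t) ^ k)" if "S \<subseteq> ?E" for S t
  proof -
    have "(\<Sum>i\<in>?E. complex_of_real ((if i \<in> S then 1 else 0) + t) * A i $$ (r, c)) = N S r c + of_real t * N ?E r c" for r c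
    proof -
      have "(\<Sum>i\<in>?E. complex_of_real ((if i \<in> S then 1 else 0) + t) * A i $$ (r, c)) =
        (\<Sum>i\<in>?E. if i \<in> S then a i r c else 0) + of_real t * N ?E r c"
        unfolding N_def sum_distrib_left sum.distrib[symmetric]
        by (intro sum.cong refl) (simp add: a_def algebra_simps)
      also have "(\<Sum>i\<in>?E. if i \<in> S then a i r c else 0) = (\<Sum>i\<in>?E \<inter> S. a i r c)"
        by (rule sum.inter_restrict[symmetric]) simp
      also have "?E \<inter> S = S" using that by blast
      finally show ?thesis unfolding N_def .
    qed
    then show ?thesis unfolding det by simp
  qed
  define m where "m = real (card V10_bases)"
  have card_pos: "m > 0"
    using matroid_bases_V10 finite_V10_bases by (simp add: m_def matroid_bases_def card_gt_0_iff)
  have f_const: "?f (\<lambda>i. t) = t ^ 4 * m" for t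
  proof -
    have "(\<Prod>i\<in>B. t) = t ^ 4" if "B \<in> V10_bases" for B using V10_basesD[OF that] by simp
    then show ?thesis by (simp add: basis_gen_poly_def m_def)
  qed
  have N_scale: "det (mat d d (\<lambda>(r,c). of_real t * N ?E r c)) = of_real ((t ^ 4 * m) ^ k)" for t
    using detN[of "{}" t] by (simp add: N_def f_const[of t, simplified])
  \<comment> \<open>This makes \<open>N ?E\<close> definite, as the direction M in
    \<open>order_of_vanishing_le_nullity\<close> has to be.\<close>
  have KE: "K ?E = {0}"
  proof -
    have "det (mat d d (\<lambda>(r,c). N ?E r c)) \<noteq> 0" using N_scale[of 1] card_pos by simp
    then show ?thesis using ker_eq[of ?E] mker_zero_if_det_nonzero[of d "N ?E"] by simp
  qed
  \<comment> \<open>Doubling the all-ones vector multiplies the determinant by 2^d and f_10^k by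
    2^(4k), and the common value there is nonzero.\<close>
  have d: "d = 4 * k"
  proof -
    have "det (mat d d (\<lambda>(r,c). of_real 2 * N ?E r c)) = 2 ^ d * det (mat d d (\<lambda>(r,c). of_real 1 * N ?E r c))"
      using det_mat_row_factor[of d "\<lambda>_. 2" "N ?E"] by simp
    then have "complex_of_real ((2 ^ 4 * m) ^ k) = 2 ^ d * of_real ((1 ^ 4 * m) ^ k)"
      unfolding N_scale .
    then have "complex_of_real (2 ^ (4 * k) * m ^ k) = of_real (2 ^ d * m ^ k)"
      by (simp add: power_mult_distrib power_mult)
    then have "(2::real) ^ (4 * k) * m ^ k = 2 ^ d * m ^ k"
      by (simp only: of_real_eq_iff)
    then have "(2::real) ^ (4 * k) = 2 ^ d" using card_pos by simp
    then show ?thesis by (simp add: power_inject_exp)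
  qed
  \<comment> \<open>By the bound r on |B \<inter> S|, the k-th power of f_10 contains the factor
    t^((4 - r) k), whose exponent cannot exceed the nullity of \<open>N S\<close>.\<close>
  have lower: "(4 - r) * k \<le> cfun.dim (K S)"
    if S: "S \<subseteq> ?E" and r: "\<And>B. B \<in> V10_bases \<Longrightarrow> card (B \<inter> S) \<le> r" "r \<le> 4" for S r
  proof -
    define H where "H = (\<lambda>t::real. \<Sum>B\<in>V10_bases. t ^ (r - card (B \<inter> S)) * (1 + t) ^ card (B \<inter> S))"
    have fS: "?f (\<lambda>i. (if i \<in> S then 1 else 0) + t) = t ^ (4 - r) * H t" for t
      unfolding H_def using V10_basesD r
      by (intro basis_gen_poly_perturbed_indicator) auto
    have "(4 - r) * k \<le> cfun.dim (mker d (N S))"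
    proof (rule order_of_vanishing_le_nullity[where M = "N ?E" and h = "\<lambda>t. of_real (H t ^ k)" and ?h0.0 = "of_real (H 0 ^ k)"])
      fix r c assume "r < d" "c < d"
      then have "a i c r = cnj (a i r c)" if "i \<in> S" for i using S that by (intro herm) auto
      then show "N S c r = cnj (N S r c)" unfolding N_def cnj_sum by (intro sum.cong refl)
    next
      fix y assume "y \<in> cvecs d" "mform d (N ?E) y y = 0"
      then have "y \<in> K ?E" by (intro K_of_mform) auto
      then show "y = 0" using KE by simp
    next
      fix t :: real
      show "det (mat d d (\<lambda>(i,j). N S i j + of_real t * N ?E i j)) = of_real t ^ ((4 - r) * k) * of_real (H t ^ k)"
        unfolding detN[OF S] fS by (simp add: power_mult_distrib power_mult)
    next
      have "isCont (\<lambda>t. complex_of_real (H t ^ k)) 0" unfolding H_def by (intro continuous_intros)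
      then show "((\<lambda>t. complex_of_real (H t ^ k)) \<longlongrightarrow> of_real (H 0 ^ k)) (at_right 0)"
        unfolding isCont_def by (rule filterlim_at_split[THEN iffD1, THEN conjunct2])
    qed
    then show ?thesis unfolding ker_eq[OF S] .
  qed
  have single: "3 * k \<le> cfun.dim (K {i})" if "i \<in> ?E" for i
  proof -
    have "card (B \<inter> {i}) \<le> 1" for B by (rule order_trans[OF card_mono[of "{i}"]]) auto
    then show ?thesis using lower[of "{i}" 1] that by simp
  qed
  have hyper: "k \<le> cfun.dim (K S)" if "S \<in> V10_circuit_hyperplanes" "S \<subseteq> ?E" for S
    using lower[of S 3] card_Int_V10_circuit_hyperplane[OF that(1)] that(2) by simp
  have basis: "K B = {0}" if "B \<in> V10_bases" for B
  proof -
    have B: "B \<subseteq> ?E" using V10_basesD[OF that] by blast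
    have "?f (\<lambda>i. (if i \<in> B then 1 else 0)) = 1"
      using that V10_basesD by (intro basis_gen_poly_indicator[where n = 4] finite_V10_bases) auto
    then have "det (mat d d (\<lambda>(r,c). N B r c)) = 1" using detN[OF B, of 0] by simp
    then show ?thesis using ker_eq[OF B] mker_zero_if_det_nonzero[of d "N B"] by simp
  qed
  show False
  proof (rule kernel_arrangement_not_Vamos[of k d K, OF assms d subK UnK])
    show "3 * k \<le> cfun.dim (K {3})" "3 * k \<le> cfun.dim (K {5})" "3 * k \<le> cfun.dim (K {1})"
      by (intro single; simp)+
    show "k \<le> cfun.dim (K {1,2,3,4})" "k \<le> cfun.dim (K {1,2,5,6})" "k \<le> cfun.dim (K {1,2,7,8})"
       "k \<le> cfun.dim (K {3,4,5,6})" "k \<le> cfun.dim (K {5,6,7,8})"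
      by (intro hyper; simp add: V10_circuit_hyperplanes_def)+
    show "K {1,2,3,5} = {0}" "K {1,3,5,6} = {0}" "K {1,2,5,7} = {0}" "K {3,4,7,8} = {0}"
      by (intro basis V10_basesI; simp add: V10_circuit_hyperplanes_def set_eq_subset)+
  qed
qed

theorem theorem1p1:
  shows "matroid_bases {1..10} V10_bases \<and> half_plane_property {1..10} V10_bases \<and>
    (\<forall>k::nat. k > 0 \<longrightarrow>
       \<not> has_definite_det_rep {1..10} (\<lambda>x. basis_gen_poly V10_bases x) k)"
  using matroid_bases_V10 half_plane_property_V10 no_definite_det_rep_V10 by blast

end
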